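(* Let $d_0\in(0,1)$ be fixed and let $k\ge 1$ be a fixed integer. Suppose that for every density $d\in(d_0,1)$, a random group in the positive $k$-gonal model $\mathcal{M}^+_{k}(n,d)$ satisfies Property (T) with overwhelming probability (as $n\to\infty$). Then for every $d\in(d_0,1)$, every $d'\in(d_0,d)$ and every integer $j\ge 1$, a random group in $\mathcal{M}_{jk}(n,d')$ satisfies Property (T) with overwhelming probability (as $n\to\infty$), and a random group in $\mathcal{M}^+_{jk}(n,d')$ satisfies Property (T) with overwhelming probability (as $n\to\infty$).
   Context: Let $S$ be a set of cardinality $n$, let $k\ge 1$ be an integer and let $d\in(0,1)$. The $k$-gonal model of random groups $\mathcal{M}_k(n,d)$ is the set of group presentations $\langle S\mid R\rangle$ where $R$ is a set of exactly $(2n-1)^{kd}$ (rounded down to an integer) cyclically reduced words of length $k$ on $S\cup S^{-1}$, equipped with the uniform probability measure. The positive $k$-gonal model $\mathcal{M}^+_k(n,d)$ is defined in the same way, with the same number of relators, except that the relators are required to be positive words, i.e. words of length $k$ on the alphabet $S$ (no letters from $S^{-1}$). Both models are considered for $n$ large enough that this many words exist. (In particular $\mathcal{M}_{jk}(n,d)$ has relators of length $jk$, and $(2n-1)^{jkd}$ of them.) A random group in $\mathcal{M}_k(n,d)$ (respectively $\mathcal{M}^+_k(n,d)$) satisfies a property P with overwhelming probability if, with $k$ and $d$ fixed, the probability that the group defined by a presentation in $\mathcal{M}_k(n,d)$ (respectively $\mathcal{M}^+_k(n,d)$) satisfies P tends to $1$ as $n\to\infty$. Property (T): a finitely generated group $\Gamma$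 with finite generating set $S$ has Property (T) if every unitary representation $\pi:\Gamma\to U(\mathcal{H})$ on a Hilbert space $\mathcal{H}$ that has almost invariant vectors (for every $\varepsilon>0$ there is $u_\varepsilon\in\mathcal{H}$ with $\|\pi(s)u_\varepsilon-u_\varepsilon\|<\varepsilon\|u_\varepsilon\|$ for all $s\in S$) has a nonzero vector $u$ with $\pi(g)u=u$ for all $g\in\Gamma$. *)

theory Defs
  imports
    "HOL-Algebra.Algebraic_Closure_Type"
    "HOL-Algebra.Generated_Groups"
    "HOL-Algebra.Bij"
    "HOL-Probability.Probability"
begin

section \<open>Complex Hilbert spaces and unitary representations\<close>

text \<open>
  The library has no complex inner product spaces. A Hilbert space is a module over the complex
  numbers with an explicit carrier (the ring multiplication and unit that the record type
  \<open>module\<close> inherits from \<open>ring\<close> are unused) together with an inner product that is linear in the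
  first argument and conjugate linear in the second.
\<close>

record 'h hilbert = "(complex, 'h) module" +
  inner_prod :: "'h \<Rightarrow> 'h \<Rightarrow> complex"

definition hnorm :: "('h, 'm) hilbert_scheme \<Rightarrow> 'h \<Rightarrow> real" where
  "hnorm H x = sqrt (Re (inner_prod H x x))"

locale hilbert_space = module "ring_of_type_algebra :: complex ring" H
  for H :: "'h hilbert" (structure) +
  assumes inner_add: "\<lbrakk>x \<in> carrier H; y \<in> carrier H; z \<in> carrier H\<rbrakk> \<Longrightarrow>
      inner_prod H (x \<oplus>\<^bsub>H\<^esub> y) z = inner_prod H x z + inner_prod H y z"
    and inner_smult: "\<lbrakk>x \<in> carrier H; y \<in> carrier H\<rbrakk> \<Longrightarrow>
      inner_prod H (a \<odot>\<^bsub>H\<^esub> x) y = a * inner_prod H x y"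
    and inner_commute: "\<lbrakk>x \<in> carrier H; y \<in> carrier H\<rbrakk> \<Longrightarrow>
      inner_prod H y x = cnj (inner_prod H x y)"
    and inner_pos: "\<lbrakk>x \<in> carrier H; x \<noteq> \<zero>\<^bsub>H\<^esub>\<rbrakk> \<Longrightarrow> 0 < Re (inner_prod H x x)"
    and complete: "\<lbrakk>\<And>n. f n \<in> carrier H;
        \<forall>e>0. \<exists>N::nat. \<forall>m\<ge>N. \<forall>n\<ge>N. hnorm H (f m \<ominus>\<^bsub>H\<^esub> f n) < e\<rbrakk> \<Longrightarrow>
      \<exists>x\<in>carrier H. (\<lambda>n. hnorm H (f n \<ominus>\<^bsub>H\<^esub> x)) \<longlonglongrightarrow> 0"

definition unitary_group :: "'h hilbert \<Rightarrow> ('h \<Rightarrow> 'h) monoid" where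
  "unitary_group H = (BijGroup (carrier H)) \<lparr> carrier := {U \<in> Bij (carrier H).
     (\<forall>x\<in>carrier H. \<forall>y\<in>carrier H. U (x \<oplus>\<^bsub>H\<^esub> y) = U x \<oplus>\<^bsub>H\<^esub> U y) \<and>
     (\<forall>a. \<forall>x\<in>carrier H. U (a \<odot>\<^bsub>H\<^esub> x) = a \<odot>\<^bsub>H\<^esub> U x) \<and>
     (\<forall>x\<in>carrier H. \<forall>y\<in>carrier H. inner_prod H (U x) (U y) = inner_prod H x y)} \<rparr>"

definition almost_invariant_vectors :: "'g set \<Rightarrow> 'h hilbert \<Rightarrow> ('g \<Rightarrow> 'h \<Rightarrow> 'h) \<Rightarrow> bool" where
  "almost_invariant_vectors S H \<pi> \<longleftrightarrow>
     (\<forall>\<epsilon>>0. \<exists>u\<in>carrier H. \<forall>s\<in>S. hnorm H (\<pi> s u \<ominus>\<^bsub>H\<^esub> u) < \<epsilon> * hnorm H u)"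

section \<open>Property (T)\<close>

text \<open>
  HOL cannot quantify over types inside a definition, so the clause ``for every Hilbert space''
  needs a type \<open>'h\<close> from which the underlying sets are taken. Property (T) itself is the
  instance with \<open>nat \<Rightarrow> complex\<close>, whose cardinality is that of the continuum; the theorem
  \<open>property_T_imp_property_T_on\<close> below shows that this instance implies the property for the
  Hilbert spaces carried by any other type.
\<close>

definition property_T_on :: "'h itself \<Rightarrow> ('g, 'm) monoid_scheme \<Rightarrow> 'g set \<Rightarrow> bool" where
  "property_T_on _ G S \<longleftrightarrow>
     group G \<and> finite S \<and> S \<subseteq> carrier G \<and> generate G S = carrier G \<and>
     (\<forall>(H :: 'h hilbert) \<pi>.
        hilbert_space H \<and> \<pi> \<in> hom G (unitary_group H) \<and> almost_invariant_vectors S H \<pi> \<longrightarrow>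
        (\<exists>u\<in>carrier H. u \<noteq> \<zero>\<^bsub>H\<^esub> \<and> (\<forall>g\<in>carrier G. \<pi> g u = u)))"

definition property_T :: "('g, 'm) monoid_scheme \<Rightarrow> 'g set \<Rightarrow> bool" where
  "property_T G S \<longleftrightarrow> property_T_on TYPE(nat \<Rightarrow> complex) G S"

section \<open>Group presentations\<close>

text \<open>The letter \<open>(s, True)\<close> stands for \<open>s\<close> and \<open>(s, False)\<close> for its inverse.\<close>

type_synonym 'a word = "('a \<times> bool) list"

definition inv_letter :: "'a \<times> bool \<Rightarrow> 'a \<times> bool" where
  "inv_letter x = (fst x, \<not> snd x)"

definition words :: "'a set \<Rightarrow> 'a word set" where
  "words S = lists (S \<times> UNIV)"

text \<open>
  Two words represent the same element of \<open>\<langle>S | R\<rangle>\<close> iff they are connected by finitely many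
  insertions and deletions of relators and of cancelling pairs of letters.
\<close>

definition deletion :: "'a set \<Rightarrow> 'a word set \<Rightarrow> ('a word \<times> 'a word) set" where
  "deletion S R = {(u @ c @ v, u @ v) | u c v. u \<in> words S \<and> v \<in> words S \<and>
     (c \<in> R \<or> (\<exists>x \<in> S \<times> UNIV. c = [x, inv_letter x]))}"

definition word_rel :: "'a set \<Rightarrow> 'a word set \<Rightarrow> ('a word \<times> 'a word) set" where
  "word_rel S R = (deletion S R \<union> (deletion S R)\<inverse>)\<^sup>* \<inter> (words S \<times> words S)"

definition presented_group :: "'a set \<Rightarrow> 'a word set \<Rightarrow> 'a word set monoid" where
  "presented_group S R =
     \<lparr> carrier = words S // word_rel S R,
       monoid.mult = (\<lambda>A B. \<Union>u\<in>A. \<Union>v\<in>B. word_rel S R `` {u @ v}),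
       one = word_rel S R `` {[]} \<rparr>"

definition presented_gens :: "'a set \<Rightarrow> 'a word set \<Rightarrow> 'a word set set" where
  "presented_gens S R = (\<lambda>s. word_rel S R `` {[(s, True)]}) ` S"

section \<open>The two models of random groups\<close>

definition cyclically_reduced :: "'a word \<Rightarrow> bool" where
  "cyclically_reduced w \<longleftrightarrow>
     (\<forall>i<length w. w ! (Suc i mod length w) \<noteq> inv_letter (w ! i))"

definition cyc_reduced_words :: "nat \<Rightarrow> nat \<Rightarrow> nat word set" where
  "cyc_reduced_words n k = {w \<in> words {..<n}. length w = k \<and> cyclically_reduced w}"

definition positive_words :: "nat \<Rightarrow> nat \<Rightarrow> nat word set" where
  "positive_words n k = {w \<in> lists ({..<n} \<times> {True}). length w = k}"

definition num_relators :: "nat \<Rightarrow> nat \<Rightarrow> real \<Rightarrow> nat" where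
  "num_relators k n d = nat \<lfloor>(2 * real n - 1) powr (real k * d)\<rfloor>"

text \<open>
  The generating set is \<open>{..<n}\<close>, so a presentation is given by its set of relators. For the
  finitely many \<open>n\<close> (given \<open>k \<ge> 1\<close> and \<open>0 < d < 1\<close>) for which there are too few words, \<open>pmf_of_set\<close> is applied to the empty set
  and the distribution is unspecified.
\<close>

definition gonal_model :: "nat \<Rightarrow> real \<Rightarrow> nat \<Rightarrow> nat word set pmf" where
  "gonal_model k d n =
     pmf_of_set {R. R \<subseteq> cyc_reduced_words n k \<and> card R = num_relators k n d}"

definition positive_gonal_model :: "nat \<Rightarrow> real \<Rightarrow> nat \<Rightarrow> nat word set pmf" where
  "positive_gonal_model k d n =
     pmf_of_set {R. R \<subseteq> positive_words n k \<and> card R = num_relators k n d}"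

definition overwhelming_T :: "(nat \<Rightarrow> nat word set pmf) \<Rightarrow> bool" where
  "overwhelming_T M \<longleftrightarrow>
     (\<lambda>n. measure_pmf.prob (M n)
        {R. property_T (presented_group {..<n} R) (presented_gens {..<n} R)}) \<longlonglongrightarrow> 1"

section \<open>The presented group is a group generated by the letters\<close>

lemma words_append: "u @ v \<in> words S \<longleftrightarrow> u \<in> words S \<and> v \<in> words S"
  by (auto simp: words_def)

lemma words_Cons: "x # v \<in> words S \<longleftrightarrow> x \<in> S \<times> UNIV \<and> v \<in> words S"
  by (auto simp: words_def)

lemma Nil_in_words: "[] \<in> words S"
  by (simp add: words_def)

lemma equiv_word_rel: "equiv (words S) (word_rel S R)"
proof (rule equivI)
  show "word_rel S R \<subseteq> words S \<times> words S" by (simp add: word_rel_def)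
  show "refl_on (words S) (word_rel S R)"
    by (auto simp: refl_on_def word_rel_def)
  have "sym ((deletion S R \<union> (deletion S R)\<inverse>)\<^sup>*)"
    by (intro sym_rtrancl) (auto simp: sym_def)
  then show "sym (word_rel S R)" by (auto simp: sym_def word_rel_def)
  show "trans (word_rel S R)" by (auto simp: trans_def word_rel_def intro: rtrancl_trans)
qed

lemma deletion_append:
  assumes "(a, b) \<in> deletion S R" "w \<in> words S" "w' \<in> words S"
  shows "(w @ a @ w', w @ b @ w') \<in> deletion S R"
proof -
  from assms(1) obtain u c v where *: "a = u @ c @ v" "b = u @ v" "u \<in> words S" "v \<in> words S"
    "c \<in> R \<or> (\<exists>x \<in> S \<times> UNIV. c = [x, inv_letter x])"
    unfolding deletion_def by blast
  have "w @ a @ w' = (w @ u) @ c @ (v @ w')" "w @ b @ w' = (w @ u) @ (v @ w')"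
    "w @ u \<in> words S" "v @ w' \<in> words S"
    using * assms by (simp_all add: words_append)
  with *(5) show ?thesis unfolding deletion_def by blast
qed

lemma word_rel_append:
  assumes "(a, b) \<in> word_rel S R" "(c, d) \<in> word_rel S R"
  shows "(a @ c, b @ d) \<in> word_rel S R"
proof -
  have step: "(w @ x @ w', w @ y @ w') \<in> (deletion S R \<union> (deletion S R)\<inverse>)\<^sup>*"
    if "(x, y) \<in> (deletion S R \<union> (deletion S R)\<inverse>)\<^sup>*" "w \<in> words S" "w' \<in> words S" for x y w w'
    using that(1)
  proof induction
    case (step y z)
    then have "(w @ y @ w', w @ z @ w') \<in> deletion S R \<union> (deletion S R)\<inverse>"
      using deletion_append that(2,3) by blast
    with step.IH show ?case by (rule rtrancl_into_rtrancl)
  qed simp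
  from assms have ws: "a \<in> words S" "b \<in> words S" "c \<in> words S" "d \<in> words S"
    by (auto simp: word_rel_def)
  have "([] @ a @ c, [] @ b @ c) \<in> (deletion S R \<union> (deletion S R)\<inverse>)\<^sup>*"
    using assms ws Nil_in_words by (intro step) (auto simp: word_rel_def)
  moreover have "(b @ c @ [], b @ d @ []) \<in> (deletion S R \<union> (deletion S R)\<inverse>)\<^sup>*"
    using assms ws Nil_in_words by (intro step) (auto simp: word_rel_def)
  ultimately show ?thesis
    using ws by (auto simp: word_rel_def words_append)
qed

lemma presented_mult:
  assumes "u \<in> words S" "v \<in> words S"
  shows "word_rel S R `` {u} \<otimes>\<^bsub>presented_group S R\<^esub> word_rel S R `` {v} = word_rel S R `` {u @ v}"
proof -
  have "word_rel S R `` {a @ b} = word_rel S R `` {u @ v}"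
    if "a \<in> word_rel S R `` {u}" "b \<in> word_rel S R `` {v}" for a b
    using that word_rel_append equiv_class_eq[OF equiv_word_rel] by (metis Image_singleton_iff)
  moreover have "u \<in> word_rel S R `` {u}" "v \<in> word_rel S R `` {v}"
    using assms equiv_class_self[OF equiv_word_rel] by blast+
  ultimately show ?thesis unfolding presented_group_def monoid.simps by blast
qed

definition inv_word :: "'a word \<Rightarrow> 'a word" where
  "inv_word w = rev (map inv_letter w)"

lemma inv_word_in_words: "w \<in> words S \<Longrightarrow> inv_word w \<in> words S"
  by (induction w) (auto simp: inv_word_def words_def inv_letter_def)

lemma inv_inv_letter: "inv_letter (inv_letter x) = x"
  by (simp add: inv_letter_def)

lemma word_rel_cancel:
  assumes "x \<in> S \<times> UNIV"
  shows "([x, inv_letter x], []) \<in> word_rel S R"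
proof -
  have "([] @ [x, inv_letter x] @ [], [] @ []) \<in> deletion S R"
    unfolding deletion_def using assms Nil_in_words by blast
  then have "([x, inv_letter x], []) \<in> (deletion S R \<union> (deletion S R)\<inverse>)\<^sup>*" by auto
  moreover have "inv_letter x \<in> S \<times> UNIV" using assms by (auto simp: inv_letter_def)
  ultimately show ?thesis using assms by (auto simp: word_rel_def words_Cons Nil_in_words)
qed

lemma word_rel_refl: "w \<in> words S \<Longrightarrow> (w, w) \<in> word_rel S R"
  by (auto simp: word_rel_def)

lemma word_rel_trans: "(a, b) \<in> word_rel S R \<Longrightarrow> (b, c) \<in> word_rel S R \<Longrightarrow> (a, c) \<in> word_rel S R"
  using equiv_word_rel by (meson equivE transD)

lemma inv_word_cancel:
  assumes "w \<in> words S"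
  shows "(inv_word w @ w, []) \<in> word_rel S R"
  using assms
proof (induction w)
  case Nil
  then show ?case by (simp add: inv_word_def word_rel_refl)
next
  case (Cons x w)
  then have x: "inv_letter x \<in> S \<times> UNIV" and w: "w \<in> words S"
    by (auto simp: words_Cons inv_letter_def)
  have "([inv_letter x, x], []) \<in> word_rel S R"
    using word_rel_cancel[OF x] by (simp add: inv_inv_letter)
  then have "(inv_word w @ [inv_letter x, x] @ w, inv_word w @ [] @ w) \<in> word_rel S R"
    using w by (intro word_rel_append word_rel_refl inv_word_in_words)
  then show ?case
    using word_rel_trans Cons.IH[OF w] by (fastforce simp: inv_word_def)
qed

lemma presented_carrierE:
  assumes "A \<in> carrier (presented_group S R)"
  obtains w where "w \<in> words S" "A = word_rel S R `` {w}"
  using assms unfolding presented_group_def by (auto elim: quotientE)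

lemma presented_carrierI: "w \<in> words S \<Longrightarrow> word_rel S R `` {w} \<in> carrier (presented_group S R)"
  by (simp add: presented_group_def quotientI)

lemma presented_one: "\<one>\<^bsub>presented_group S R\<^esub> = word_rel S R `` {[]}"
  by (simp add: presented_group_def)

theorem group_presented_group: "group (presented_group S R)"
proof (rule groupI)
  show "\<one>\<^bsub>presented_group S R\<^esub> \<in> carrier (presented_group S R)"
    by (simp add: presented_one presented_carrierI Nil_in_words)
next
  fix A B assume "A \<in> carrier (presented_group S R)" "B \<in> carrier (presented_group S R)"
  then show "A \<otimes>\<^bsub>presented_group S R\<^esub> B \<in> carrier (presented_group S R)"
    by (elim presented_carrierE) (simp add: presented_mult presented_carrierI words_append)
next
  fix A B C assume "A \<in> carrier (presented_group S R)" "B \<in> carrier (presented_group S R)"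
    "C \<in> carrier (presented_group S R)"
  then show "A \<otimes>\<^bsub>presented_group S R\<^esub> B \<otimes>\<^bsub>presented_group S R\<^esub> C =
      A \<otimes>\<^bsub>presented_group S R\<^esub> (B \<otimes>\<^bsub>presented_group S R\<^esub> C)"
    by (elim presented_carrierE) (simp add: presented_mult words_append)
next
  fix A assume "A \<in> carrier (presented_group S R)"
  then obtain w where w: "w \<in> words S" "A = word_rel S R `` {w}" by (rule presented_carrierE)
  then show "\<one>\<^bsub>presented_group S R\<^esub> \<otimes>\<^bsub>presented_group S R\<^esub> A = A"
    by (simp add: presented_one presented_mult Nil_in_words)
  have "word_rel S R `` {inv_word w} \<otimes>\<^bsub>presented_group S R\<^esub> A = \<one>\<^bsub>presented_group S R\<^esub>"
    using w equiv_class_eq[OF equiv_word_rel inv_word_cancel[OF w(1)], of R]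
    by (simp add: presented_mult inv_word_in_words presented_one)
  then show "\<exists>B\<in>carrier (presented_group S R). B \<otimes>\<^bsub>presented_group S R\<^esub> A = \<one>\<^bsub>presented_group S R\<^esub>"
    using w inv_word_in_words presented_carrierI by blast
qed

theorem generate_presented_gens:
  "generate (presented_group S R) (presented_gens S R) = carrier (presented_group S R)"
proof
  interpret group "presented_group S R" by (rule group_presented_group)
  have gens: "presented_gens S R \<subseteq> carrier (presented_group S R)"
    by (auto simp: presented_gens_def words_Cons Nil_in_words intro!: presented_carrierI)
  then show "generate (presented_group S R) (presented_gens S R) \<subseteq> carrier (presented_group S R)"
    by (rule generate_incl)
  have letter: "word_rel S R `` {[x]} \<in> generate (presented_group S R) (presented_gens S R)"
    if "x \<in> S \<times> UNIV" for x
  proof (cases "snd x")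
    case True
    with that have "word_rel S R `` {[x]} \<in> presented_gens S R"
      by (cases x) (auto simp: presented_gens_def)
    then show ?thesis by (rule generate.incl)
  next
    case False
    let ?y = "inv_letter x"
    have y: "word_rel S R `` {[?y]} \<in> presented_gens S R"
      using False that by (cases x) (auto simp: presented_gens_def inv_letter_def)
    have yw: "[?y] \<in> words S" and xw: "[x] \<in> words S"
      using that by (auto simp: words_Cons Nil_in_words inv_letter_def)
    have "word_rel S R `` {[x]} \<otimes>\<^bsub>presented_group S R\<^esub> word_rel S R `` {[?y]} =
        \<one>\<^bsub>presented_group S R\<^esub>"
      using word_rel_cancel[OF that] xw yw
      by (simp add: presented_mult presented_one equiv_class_eq[OF equiv_word_rel])
    then have "inv\<^bsub>presented_group S R\<^esub> (word_rel S R `` {[?y]}) = word_rel S R `` {[x]}"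
      using xw yw presented_carrierI by (metis inv_equality)
    then show ?thesis using generate.inv[OF y] by metis
  qed
  have "word_rel S R `` {w} \<in> generate (presented_group S R) (presented_gens S R)"
    if "w \<in> words S" for w
    using that
  proof (induction w)
    case Nil
    show ?case using generate.one by (metis presented_one)
  next
    case (Cons x w)
    then have "word_rel S R `` {x # w} =
        word_rel S R `` {[x]} \<otimes>\<^bsub>presented_group S R\<^esub> word_rel S R `` {w}"
      by (simp add: presented_mult words_Cons Nil_in_words)
    then show ?case using Cons letter by (metis generate.eng words_Cons)
  qed
  then show "carrier (presented_group S R) \<subseteq> generate (presented_group S R) (presented_gens S R)"
    by (auto elim: presented_carrierE)
qed

section \<open>Property (T) does not depend on the carrier type\<close>

text \<open>
  A representation without invariant vectors restricts to a separable invariant subspace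
  containing a sequence of almost invariant vectors. Its points are encoded by sequences of
  indices into a countable dense subset, and the structure is transported along this encoding.
\<close>

subsection \<open>Basic facts about the norm\<close>

context hilbert_space
begin

lemma complex_ring_simps:
  "carrier (ring_of_type_algebra :: complex ring) = UNIV"
  "a \<oplus>\<^bsub>ring_of_type_algebra\<^esub> b = a + (b :: complex)"
  "a \<otimes>\<^bsub>ring_of_type_algebra\<^esub> b = a * (b :: complex)"
  "\<one>\<^bsub>ring_of_type_algebra\<^esub> = (1 :: complex)"
  by (simp_all add: ring_of_type_algebra_def)

lemma smult_closed': "x \<in> carrier H \<Longrightarrow> a \<odot> x \<in> carrier H"
  using smult_closed by (simp add: complex_ring_simps)

lemma smult_add_left: "x \<in> carrier H \<Longrightarrow> (a + b) \<odot> x = a \<odot> x \<oplus> b \<odot> x"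
  using smult_l_distr[of a b x] by (simp add: complex_ring_simps)

lemma smult_add_right: "x \<in> carrier H \<Longrightarrow> y \<in> carrier H \<Longrightarrow> a \<odot> (x \<oplus> y) = a \<odot> x \<oplus> a \<odot> y"
  using smult_r_distr[of a x y] by (simp add: complex_ring_simps)

lemma smult_assoc: "x \<in> carrier H \<Longrightarrow> (a * b) \<odot> x = a \<odot> (b \<odot> x)"
  using smult_assoc1[of a b x] by (simp add: complex_ring_simps)

lemma smult_1: "x \<in> carrier H \<Longrightarrow> 1 \<odot> x = x"
  using smult_one[of x] by (simp add: complex_ring_simps)

lemma inner_zero_left: "y \<in> carrier H \<Longrightarrow> inner_prod H \<zero> y = 0"
  using inner_add[of \<zero> \<zero> y] by simp

lemma inner_neg: "x \<in> carrier H \<Longrightarrow> y \<in> carrier H \<Longrightarrow> inner_prod H (\<ominus> x) y = - inner_prod H x y"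
  using inner_add[of x "\<ominus> x" y] inner_zero_left
  by (simp add: M.r_neg add_eq_0_iff)

lemma inner_add_right:
  "x \<in> carrier H \<Longrightarrow> y \<in> carrier H \<Longrightarrow> z \<in> carrier H \<Longrightarrow>
    inner_prod H z (x \<oplus> y) = inner_prod H z x + inner_prod H z y"
  using inner_add[of x y z] inner_commute[of x z] inner_commute[of y z] inner_commute[of "x \<oplus> y" z]
  by simp

lemma inner_smult_right:
  "x \<in> carrier H \<Longrightarrow> y \<in> carrier H \<Longrightarrow> inner_prod H y (a \<odot> x) = cnj a * inner_prod H y x"
  using inner_smult[of x y a] inner_commute[of x y] inner_commute[of "a \<odot> x" y]
  by (simp add: smult_closed')

lemma inner_self_Im: "x \<in> carrier H \<Longrightarrow> Im (inner_prod H x x) = 0"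
  using inner_commute[of x x] by (metis cnj.simps(2) neg_equal_zero)

lemma inner_self_nonneg: "x \<in> carrier H \<Longrightarrow> 0 \<le> Re (inner_prod H x x)"
  using inner_pos[of x] inner_zero_left[of \<zero>] by (cases "x = \<zero>") auto

lemma hnorm_nonneg: "x \<in> carrier H \<Longrightarrow> 0 \<le> hnorm H x"
  by (simp add: hnorm_def inner_self_nonneg)

lemma hnorm_square: "x \<in> carrier H \<Longrightarrow> (hnorm H x)\<^sup>2 = Re (inner_prod H x x)"
  by (simp add: hnorm_def inner_self_nonneg)

lemma hnorm_zero: "hnorm H \<zero> = 0"
  by (simp add: hnorm_def inner_zero_left)

lemma hnorm_eq_0: "x \<in> carrier H \<Longrightarrow> hnorm H x = 0 \<Longrightarrow> x = \<zero>"
  using inner_pos[of x] by (fastforce simp: hnorm_def)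

lemma hnorm_smult:
  assumes "x \<in> carrier H" shows "hnorm H (a \<odot> x) = cmod a * hnorm H x"
proof -
  have "inner_prod H (a \<odot> x) (a \<odot> x) = (a * cnj a) * inner_prod H x x"
    using assms by (simp add: inner_smult inner_smult_right smult_closed')
  also have "a * cnj a = of_real ((cmod a)\<^sup>2)" by (rule complex_norm_square[symmetric])
  finally show ?thesis by (simp add: hnorm_def real_sqrt_mult)
qed

lemma smult_m1: "x \<in> carrier H \<Longrightarrow> (-1) \<odot> x = \<ominus> x"
proof -
  assume x: "x \<in> carrier H"
  have "0 \<odot> x = \<zero>"
    using hnorm_smult[OF x, of 0] hnorm_eq_0[of "0 \<odot> x"] x by (simp add: smult_closed')
  then have "x \<oplus> (-1) \<odot> x = \<zero>"
    using smult_add_left[OF x, of 1 "-1"] x by (simp add: smult_1)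
  then show ?thesis
    using x by (metis M.minus_equality M.a_comm smult_closed')
qed

lemma hnorm_neg: "x \<in> carrier H \<Longrightarrow> hnorm H (\<ominus> x) = hnorm H x"
  using hnorm_smult[of x "-1"] by (simp add: smult_m1)

lemma hnorm_minus_commute:
  assumes "x \<in> carrier H" "y \<in> carrier H" shows "hnorm H (x \<ominus> y) = hnorm H (y \<ominus> x)"
proof -
  have "\<ominus> (y \<ominus> x) = x \<ominus> y" using assms by (simp add: a_minus_def M.minus_add M.a_comm)
  then show ?thesis using assms hnorm_neg[of "y \<ominus> x"] by simp
qed

lemma Re_inner_le:
  assumes x: "x \<in> carrier H" and y: "y \<in> carrier H"
  shows "Re (inner_prod H x y) \<le> hnorm H x * hnorm H y"
proof (cases "y = \<zero>")
  case True
  then have "inner_prod H x y = 0"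
    using inner_zero_left[OF x] inner_commute[of y x] x y by simp
  then show ?thesis using True by (simp add: hnorm_zero)
next
  case False
  define r where "r = Re (inner_prod H x y)"
  define N where "N = Re (inner_prod H y y)"
  define t where "t = r / N"
  have N: "N > 0" using inner_pos[OF y False] by (simp add: N_def)
  have sc: "of_real (-t) \<odot> y \<in> carrier H" using y by (rule smult_closed')
  have yx: "Re (inner_prod H y x) = r" using inner_commute[OF x y] by (simp add: r_def)
  have "0 \<le> Re (inner_prod H (x \<oplus> of_real (-t) \<odot> y) (x \<oplus> of_real (-t) \<odot> y))"
    using x sc by (intro inner_self_nonneg) simp
  also have "\<dots> = (hnorm H x)\<^sup>2 - 2 * t * r + t\<^sup>2 * N"
    using x y sc yx
    by (simp add: inner_add inner_add_right inner_smult inner_smult_right hnorm_square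
        r_def[symmetric] N_def[symmetric] algebra_simps power2_eq_square[of t])
  also have "\<dots> = (hnorm H x)\<^sup>2 - r\<^sup>2 / N"
    using N by (simp add: t_def power2_eq_square field_simps)
  finally have "r\<^sup>2 \<le> (hnorm H x)\<^sup>2 * N" using N by (simp add: field_simps)
  also have "\<dots> = (hnorm H x * hnorm H y)\<^sup>2"
    using y by (simp add: N_def hnorm_square power_mult_distrib)
  finally show ?thesis
    unfolding r_def[symmetric] using hnorm_nonneg x y by (meson mult_nonneg_nonneg power2_le_imp_le)
qed

lemma hnorm_triangle:
  assumes x: "x \<in> carrier H" and y: "y \<in> carrier H"
  shows "hnorm H (x \<oplus> y) \<le> hnorm H x + hnorm H y"
proof -
  have "Re (inner_prod H y x) = Re (inner_prod H x y)" using inner_commute[OF x y] by simp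
  then have "(hnorm H (x \<oplus> y))\<^sup>2 = (hnorm H x)\<^sup>2 + (hnorm H y)\<^sup>2 + 2 * Re (inner_prod H x y)"
    using x y by (simp add: hnorm_square inner_add inner_add_right)
  also have "\<dots> \<le> (hnorm H x + hnorm H y)\<^sup>2"
    using Re_inner_le[OF x y] by (simp add: power2_sum)
  finally show ?thesis using hnorm_nonneg x y by (meson add_nonneg_nonneg power2_le_imp_le)
qed

lemma hnorm_diff_triangle:
  assumes "x \<in> carrier H" "y \<in> carrier H" "z \<in> carrier H"
  shows "hnorm H (x \<ominus> z) \<le> hnorm H (x \<ominus> y) + hnorm H (y \<ominus> z)"
proof -
  have "x \<ominus> z = (x \<ominus> y) \<oplus> (y \<ominus> z)"
    using assms by (simp add: a_minus_def M.a_ac M.r_neg1 M.r_neg2)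
  then show ?thesis using assms hnorm_triangle[of "x \<ominus> y" "y \<ominus> z"] by simp
qed

lemma smult_diff_right:
  assumes "x \<in> carrier H" "y \<in> carrier H" shows "a \<odot> (x \<ominus> y) = a \<odot> x \<ominus> a \<odot> y"
proof -
  have "a \<odot> (\<ominus> y) = \<ominus> (a \<odot> y)"
    using assms smult_assoc[of y a "-1"] smult_assoc[of y "-1" a]
    by (simp add: smult_m1 smult_closed')
  then show ?thesis using assms by (simp add: a_minus_def smult_add_right)
qed

lemma smult_diff_left:
  assumes "x \<in> carrier H" shows "(a - b) \<odot> x = a \<odot> x \<ominus> b \<odot> x"
proof -
  have "(- b) \<odot> x = \<ominus> (b \<odot> x)"
    using assms smult_assoc[of x "-1" b] by (simp add: smult_m1 smult_closed')
  then show ?thesis using assms smult_add_left[of x a "-b"] by (simp add: a_minus_def)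
qed

end

subsection \<open>Transport of a closed subspace along an injection\<close>

definition hilbert_transport :: "'h hilbert \<Rightarrow> 'h set \<Rightarrow> ('h \<Rightarrow> 'k) \<Rightarrow> 'k hilbert" where
  "hilbert_transport H K \<phi> =
     \<lparr> carrier = \<phi> ` K,
       monoid.mult = (\<lambda>_ _. \<phi> \<zero>\<^bsub>H\<^esub>),
       one = \<phi> \<zero>\<^bsub>H\<^esub>,
       ring.zero = \<phi> \<zero>\<^bsub>H\<^esub>,
       add = (\<lambda>x y. \<phi> (inv_into K \<phi> x \<oplus>\<^bsub>H\<^esub> inv_into K \<phi> y)),
       module.smult = (\<lambda>a x. \<phi> (a \<odot>\<^bsub>H\<^esub> inv_into K \<phi> x)),
       inner_prod = (\<lambda>x y. inner_prod H (inv_into K \<phi> x) (inv_into K \<phi> y)) \<rparr>"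

locale transported_hilbert_space = hilbert_space H for H :: "'h hilbert" (structure) +
  fixes K :: "'h set" and \<phi> :: "'h \<Rightarrow> 'k"
  assumes inj: "inj_on \<phi> K"
    and sub: "K \<subseteq> carrier H"
    and zero_K: "\<zero> \<in> K"
    and add_K: "\<lbrakk>x \<in> K; y \<in> K\<rbrakk> \<Longrightarrow> x \<oplus> y \<in> K"
    and smult_K: "x \<in> K \<Longrightarrow> a \<odot> x \<in> K"
    and lim_K: "\<lbrakk>\<And>n::nat. f n \<in> K; x \<in> carrier H; (\<lambda>n. hnorm H (f n \<ominus> x)) \<longlonglongrightarrow> 0\<rbrakk> \<Longrightarrow> x \<in> K"
begin

abbreviation "H' \<equiv> hilbert_transport H K \<phi>"

lemma transport_simps:
  "carrier H' = \<phi> ` K"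
  "\<zero>\<^bsub>H'\<^esub> = \<phi> \<zero>"
  "\<lbrakk>x \<in> K; y \<in> K\<rbrakk> \<Longrightarrow> \<phi> x \<oplus>\<^bsub>H'\<^esub> \<phi> y = \<phi> (x \<oplus> y)"
  "x \<in> K \<Longrightarrow> a \<odot>\<^bsub>H'\<^esub> \<phi> x = \<phi> (a \<odot> x)"
  "\<lbrakk>x \<in> K; y \<in> K\<rbrakk> \<Longrightarrow> inner_prod H' (\<phi> x) (\<phi> y) = inner_prod H x y"
  "x \<in> K \<Longrightarrow> hnorm H' (\<phi> x) = hnorm H x"
  by (simp_all add: hilbert_transport_def inj hnorm_def)

lemma neg_K: "x \<in> K \<Longrightarrow> \<ominus> x \<in> K"
  using smult_K[of x "-1"] sub by (auto simp: smult_m1)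

lemma minus_K: "x \<in> K \<Longrightarrow> y \<in> K \<Longrightarrow> x \<ominus> y \<in> K"
  by (simp add: a_minus_def add_K neg_K)

lemma abelian_group_transport: "abelian_group H'"
proof (rule abelian_groupI)
  fix x assume "x \<in> carrier H'"
  then obtain x' where x': "x = \<phi> x'" "x' \<in> K" by (auto simp: transport_simps)
  then have "\<phi> (\<ominus> x') \<in> carrier H'" "\<phi> (\<ominus> x') \<oplus>\<^bsub>H'\<^esub> x = \<zero>\<^bsub>H'\<^esub>"
    using sub neg_K by (auto simp: transport_simps M.l_neg)
  then show "\<exists>y\<in>carrier H'. y \<oplus>\<^bsub>H'\<^esub> x = \<zero>\<^bsub>H'\<^esub>" by blast
next
  show "\<zero>\<^bsub>H'\<^esub> \<in> carrier H'" using zero_K by (simp add: transport_simps)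
next
  fix x y z assume "x \<in> carrier H'" "y \<in> carrier H'" "z \<in> carrier H'"
  then show "x \<oplus>\<^bsub>H'\<^esub> y \<oplus>\<^bsub>H'\<^esub> z = x \<oplus>\<^bsub>H'\<^esub> (y \<oplus>\<^bsub>H'\<^esub> z)"
    using sub add_K by (auto simp: transport_simps M.a_assoc subset_iff)
next
  fix x y assume "x \<in> carrier H'" "y \<in> carrier H'"
  then show "x \<oplus>\<^bsub>H'\<^esub> y = y \<oplus>\<^bsub>H'\<^esub> x"
    using sub by (auto simp: transport_simps M.a_comm subset_iff)
next
  fix x y assume "x \<in> carrier H'" "y \<in> carrier H'"
  then show "x \<oplus>\<^bsub>H'\<^esub> y \<in> carrier H'" using add_K by (auto simp: transport_simps)
next
  fix x assume "x \<in> carrier H'"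
  then show "\<zero>\<^bsub>H'\<^esub> \<oplus>\<^bsub>H'\<^esub> x = x"
    using sub zero_K by (auto simp: transport_simps subset_iff)
qed

lemma transport_minus:
  assumes "x \<in> K" "y \<in> K" shows "\<phi> x \<ominus>\<^bsub>H'\<^esub> \<phi> y = \<phi> (x \<ominus> y)"
proof -
  interpret H': abelian_group H' by (rule abelian_group_transport)
  have "\<phi> (\<ominus> y) \<oplus>\<^bsub>H'\<^esub> \<phi> y = \<zero>\<^bsub>H'\<^esub>"
    using assms sub neg_K by (auto simp: transport_simps M.l_neg)
  then have "\<ominus>\<^bsub>H'\<^esub> \<phi> y = \<phi> (\<ominus> y)"
    using assms neg_K by (intro H'.minus_equality) (auto simp: transport_simps)
  then show ?thesis using assms neg_K by (simp add: a_minus_def transport_simps)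
qed

lemma hilbert_space_transport: "hilbert_space H'"
proof -
  have "module (ring_of_type_algebra :: complex ring) H'"
  proof (rule moduleI)
    show "cring (ring_of_type_algebra :: complex ring)" by (rule cring_from_type_algebra)
    show "abelian_group H'" by (rule abelian_group_transport)
  qed (use sub add_K smult_K in \<open>auto simp: complex_ring_simps transport_simps subset_iff
      smult_add_left smult_add_right smult_assoc smult_1\<close>)
  moreover have "hilbert_space_axioms H'"
  proof (rule hilbert_space_axioms.intro)
    fix f :: "nat \<Rightarrow> 'k"
    assume f: "\<And>n. f n \<in> carrier H'"
      and cauchy: "\<forall>e>0. \<exists>N. \<forall>m\<ge>N. \<forall>n\<ge>N. hnorm H' (f m \<ominus>\<^bsub>H'\<^esub> f n) < e"
    have "\<exists>x. x \<in> K \<and> f n = \<phi> x" for n using f[of n] by (auto simp: transport_simps)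
    then obtain g where g: "\<And>n. g n \<in> K" "\<And>n. f n = \<phi> (g n)" by metis
    have "\<exists>x\<in>carrier H. (\<lambda>n. hnorm H (g n \<ominus> x)) \<longlonglongrightarrow> 0"
      using cauchy sub g minus_K by (intro complete) (auto simp: transport_minus transport_simps)
    then obtain x where x: "x \<in> carrier H" "(\<lambda>n. hnorm H (g n \<ominus> x)) \<longlonglongrightarrow> 0" by blast
    then have "x \<in> K" using g lim_K by blast
    then have "\<phi> x \<in> carrier H'" "(\<lambda>n. hnorm H' (f n \<ominus>\<^bsub>H'\<^esub> \<phi> x)) \<longlonglongrightarrow> 0"
      using g x minus_K by (auto simp: transport_minus transport_simps)
    then show "\<exists>x\<in>carrier H'. (\<lambda>n. hnorm H' (f n \<ominus>\<^bsub>H'\<^esub> x)) \<longlonglongrightarrow> 0" by blast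
  next
    fix x assume "x \<in> carrier H'" "x \<noteq> \<zero>\<^bsub>H'\<^esub>"
    then obtain y where "x = \<phi> y" "y \<in> K" "y \<noteq> \<zero>" by (auto simp: transport_simps)
    then show "0 < Re (inner_prod H' x x)"
      using inner_pos[of y] sub by (auto simp: transport_simps)
  next
    fix x y assume "x \<in> carrier H'" "y \<in> carrier H'"
    then obtain a b where "x = \<phi> a" "y = \<phi> b" "a \<in> K" "b \<in> K" by (auto simp: transport_simps)
    then show "inner_prod H' y x = cnj (inner_prod H' x y)"
      using sub inner_commute[of a b] by (auto simp: transport_simps)
  next
    fix x y z assume "x \<in> carrier H'" "y \<in> carrier H'" "z \<in> carrier H'"
    then show "inner_prod H' (x \<oplus>\<^bsub>H'\<^esub> y) z = inner_prod H' x z + inner_prod H' y z"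
      using inner_add sub add_K by (auto simp: transport_simps subset_iff)
  next
    fix x y a assume "x \<in> carrier H'" "y \<in> carrier H'"
    then show "inner_prod H' (a \<odot>\<^bsub>H'\<^esub> x) y = a * inner_prod H' x y"
      using inner_smult sub smult_K by (auto simp: transport_simps subset_iff)
  qed
  ultimately show ?thesis by (rule hilbert_space.intro)
qed

end

subsection \<open>Reduction to separable subspaces\<close>

lemma (in hilbert_space) separable_invariant_subspace:
  fixes u :: "nat \<Rightarrow> 'h"
  assumes G: "group G" and S: "finite S" "S \<subseteq> carrier G" "generate G S = carrier G"
    and hom: "\<pi> \<in> hom G (unitary_group H)" and u: "\<And>m. u m \<in> carrier H"
  obtains K :: "'h set" and \<phi> :: "'h \<Rightarrow> nat \<Rightarrow> complex"
  where "transported_hilbert_space H K \<phi>" "\<And>m. u m \<in> K"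
    "\<And>g x. g \<in> carrier G \<Longrightarrow> x \<in> K \<Longrightarrow> \<pi> g x \<in> K"
proof -
  interpret G: group G by (rule G)
  have U: "\<pi> g \<in> carrier (unitary_group H)" if "g \<in> carrier G" for g
    using hom that by (auto simp: hom_def)
  have Ucl: "\<pi> g x \<in> carrier H" if "g \<in> carrier G" "x \<in> carrier H" for g x
    using U[OF that(1)] that(2) by (auto simp: unitary_group_def dest: Bij_imp_funcset)
  have Uiso: "hnorm H (\<pi> g x \<ominus> \<pi> g y) = hnorm H (x \<ominus> y)"
    if g: "g \<in> carrier G" and x: "x \<in> carrier H" and y: "y \<in> carrier H" for g x y
  proof -
    have "\<pi> g x \<ominus> \<pi> g y = \<pi> g (x \<ominus> y)"
      using U[OF g] x y Ucl[OF g] unfolding a_minus_def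
      by (simp add: unitary_group_def smult_m1[symmetric] smult_closed')
    moreover have "hnorm H (\<pi> g (x \<ominus> y)) = hnorm H (x \<ominus> y)"
      using U[OF g] x y by (simp add: unitary_group_def hnorm_def)
    ultimately show ?thesis by simp
  qed
  have Umult: "\<pi> (g \<otimes>\<^bsub>G\<^esub> h) x = \<pi> g (\<pi> h x)"
    if "g \<in> carrier G" "h \<in> carrier G" "x \<in> carrier H" for g h x
  proof -
    have "\<pi> g \<in> Bij (carrier H)" "\<pi> h \<in> Bij (carrier H)"
      using U that by (auto simp: unitary_group_def)
    then show ?thesis
      using hom that by (simp add: hom_def unitary_group_def BijGroup_def compose_eq)
  qed
  have Uone: "\<pi> \<one>\<^bsub>G\<^esub> x = x" if "x \<in> carrier H" for x
  proof -
    have "inj_on (\<pi> \<one>\<^bsub>G\<^esub>) (carrier H)"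
      using U[of "\<one>\<^bsub>G\<^esub>"] by (auto simp: unitary_group_def Bij_def bij_betw_def)
    moreover have "\<pi> \<one>\<^bsub>G\<^esub> (\<pi> \<one>\<^bsub>G\<^esub> x) = \<pi> \<one>\<^bsub>G\<^esub> x"
      using Umult[OF G.one_closed G.one_closed that] G.l_one[OF G.one_closed] by metis
    ultimately show ?thesis
      using Ucl[OF G.one_closed that] that by (rule inj_onD)
  qed
  obtain Q :: "complex set" where Q: "countable Q" "\<And>V. open V \<Longrightarrow> V \<noteq> {} \<Longrightarrow> \<exists>q\<in>Q. q \<in> V"
    using countable_dense_exists by blast
  define T where "T = S \<union> m_inv G ` S"
  have T: "countable T" "T \<subseteq> carrier G" using S by (auto simp: T_def countable_finite)
  define step where "step A = A \<union> (\<lambda>(x, y). x \<oplus> y) ` (A \<times> A) \<union> (\<lambda>(a, x). a \<odot> x) ` (Q \<times> A)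
      \<union> (\<lambda>(g, x). \<pi> g x) ` (T \<times> A)" for A
  define D where "D = (\<Union>n. (step ^^ n) (range u))"
  have "countable ((step ^^ n) (range u))" for n
    by (induction n) (auto simp: step_def Q(1) T(1))
  then have countable: "countable D" by (auto simp: D_def)
  have "(step ^^ n) (range u) \<subseteq> carrier H" for n
  proof (induction n)
    case (Suc n)
    then show ?case using T(2) by (fastforce simp: step_def intro!: Ucl smult_closed')
  qed (use u in auto)
  then have D: "D \<subseteq> carrier H" by (auto simp: D_def)
  have uD: "u m \<in> D" for m by (auto simp: D_def intro!: exI[of _ 0])
  have mono: "(step ^^ m) (range u) \<subseteq> (step ^^ (m + n)) (range u)" for m n
    by (induction n) (auto simp: step_def)
  have addD: "x \<oplus> y \<in> D" if x: "x \<in> D" and y: "y \<in> D" for x y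
  proof -
    obtain m n where "x \<in> (step ^^ m) (range u)" "y \<in> (step ^^ n) (range u)"
      using x y unfolding D_def by blast
    then have "x \<in> (step ^^ (m + n)) (range u)" "y \<in> (step ^^ (m + n)) (range u)"
      using mono[of m n] mono[of n m] by (auto simp: add.commute)
    then have "x \<oplus> y \<in> (step ^^ Suc (m + n)) (range u)" by (auto simp: step_def)
    then show ?thesis unfolding D_def by (rule UN_I[OF UNIV_I])
  qed
  have smultD: "a \<odot> x \<in> D" if a: "a \<in> Q" and x: "x \<in> D" for a x
  proof -
    obtain m where "x \<in> (step ^^ m) (range u)" using x by (auto simp: D_def)
    then have "a \<odot> x \<in> (step ^^ Suc m) (range u)" using a by (auto simp: step_def)
    then show ?thesis unfolding D_def by (rule UN_I[OF UNIV_I])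
  qed
  have actD: "\<pi> g x \<in> D" if g: "g \<in> T" and x: "x \<in> D" for g x
  proof -
    obtain m where "x \<in> (step ^^ m) (range u)" using x by (auto simp: D_def)
    then have "\<pi> g x \<in> (step ^^ Suc m) (range u)" using g by (auto simp: step_def)
    then show ?thesis unfolding D_def by (rule UN_I[OF UNIV_I])
  qed
  define K where "K = {x \<in> carrier H. \<forall>e>0. \<exists>y\<in>D. hnorm H (y \<ominus> x) < e}"
  have sub: "K \<subseteq> carrier H" by (auto simp: K_def)
  have DK: "D \<subseteq> K"
  proof
    fix x assume x: "x \<in> D"
    then have "hnorm H (x \<ominus> x) = 0" using D by (auto simp: a_minus_def M.r_neg hnorm_zero)
    then show "x \<in> K" using x D by (auto simp: K_def intro!: bexI[of _ x])
  qed
  have KE: "\<exists>y\<in>D. y \<in> carrier H \<and> hnorm H (y \<ominus> x) < e" if "x \<in> K" "e > 0" for x e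
    using that D unfolding K_def by blast
  have addK: "x \<oplus> y \<in> K" if x: "x \<in> K" and y: "y \<in> K" for x y
  proof -
    have "\<exists>z\<in>D. hnorm H (z \<ominus> (x \<oplus> y)) < e" if e: "e > 0" for e
    proof -
      obtain x' y' where *: "x' \<in> D" "y' \<in> D" "x' \<in> carrier H" "y' \<in> carrier H"
        "hnorm H (x' \<ominus> x) < e/2" "hnorm H (y' \<ominus> y) < e/2"
        using KE[OF x, of "e/2"] KE[OF y, of "e/2"] e by auto
      have xy: "x \<in> carrier H" "y \<in> carrier H" using x y sub by auto
      have "(x' \<oplus> y') \<ominus> (x \<oplus> y) = (x' \<ominus> x) \<oplus> (y' \<ominus> y)"
        using * xy by (simp add: a_minus_def M.minus_add M.a_ac)
      then have "hnorm H ((x' \<oplus> y') \<ominus> (x \<oplus> y)) < e"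
        using hnorm_triangle[of "x' \<ominus> x" "y' \<ominus> y"] * xy by simp
      then show ?thesis using addD * by blast
    qed
    then show ?thesis using x y sub by (auto simp: K_def)
  qed
  have smultK: "a \<odot> x \<in> K" if x: "x \<in> K" for a x
  proof -
    have xH: "x \<in> carrier H" using x sub by auto
    have "\<exists>z\<in>D. hnorm H (z \<ominus> a \<odot> x) < e" if e: "e > 0" for e
    proof -
      define d where "d = e / (2 * (hnorm H x + 1))"
      have nx: "hnorm H x \<ge> 0" using xH by (rule hnorm_nonneg)
      then have d: "d > 0" using e by (simp add: d_def)
      obtain q where q: "q \<in> Q" "cmod (q - a) < d"
        using Q(2)[of "ball a d"] d by (auto simp: dist_norm norm_minus_commute)
      obtain x' where x': "x' \<in> D" "x' \<in> carrier H" "hnorm H (x' \<ominus> x) < e / (2 * (cmod q + 1))"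
        using KE[OF x, of "e / (2 * (cmod q + 1))"] e by (auto simp: add_nonneg_pos)
      have "hnorm H (q \<odot> x' \<ominus> a \<odot> x)
          \<le> hnorm H (q \<odot> x' \<ominus> q \<odot> x) + hnorm H (q \<odot> x \<ominus> a \<odot> x)"
        using x' xH by (intro hnorm_diff_triangle smult_closed')
      also have "\<dots> = cmod q * hnorm H (x' \<ominus> x) + cmod (q - a) * hnorm H x"
        using x' xH by (simp add: smult_diff_left[symmetric] smult_diff_right[symmetric] hnorm_smult)
      also have "\<dots> < e"
      proof -
        have "cmod q * hnorm H (x' \<ominus> x) \<le> cmod q * (e / (2 * (cmod q + 1)))"
          using x' by (intro mult_left_mono) auto
        also have "\<dots> = e / 2 * (cmod q / (cmod q + 1))" by simp
        also have "\<dots> < e / 2 * 1"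
          using e by (intro mult_strict_left_mono) (simp_all add: add_nonneg_pos)
        finally have 1: "cmod q * hnorm H (x' \<ominus> x) < e / 2" by simp
        have "cmod (q - a) * hnorm H x \<le> d * hnorm H x"
          using q nx by (intro mult_right_mono) auto
        also have "\<dots> \<le> e / 2"
          using e nx by (simp add: d_def field_simps)
        finally show ?thesis using 1 by simp
      qed
      finally show ?thesis using smultD[OF q(1) x'(1)] by blast
    qed
    then show ?thesis using xH smult_closed' by (auto simp: K_def)
  qed
  have actT: "\<pi> g x \<in> K" if g: "g \<in> T" and x: "x \<in> K" for g x
  proof -
    have "\<exists>z\<in>D. hnorm H (z \<ominus> \<pi> g x) < e" if e: "e > 0" for e
    proof -
      obtain y where "y \<in> D" "y \<in> carrier H" "hnorm H (y \<ominus> x) < e" using KE[OF x e] by blast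
      moreover have "g \<in> carrier G" "x \<in> carrier H" using g x T(2) sub by auto
      ultimately show ?thesis using Uiso[of g y x] g actD by (intro bexI[of _ "\<pi> g y"]) auto
    qed
    then show ?thesis using Ucl g x T(2) sub by (auto simp: K_def)
  qed
  have actK: "\<pi> g x \<in> K" if "g \<in> carrier G" "x \<in> K" for g x
  proof -
    have "g \<in> generate G S" using that S by simp
    then show ?thesis using that(2)
    proof (induction arbitrary: x)
      case one
      then show ?case using Uone sub by auto
    next
      case (incl h)
      then show ?case using actT by (auto simp: T_def)
    next
      case (inv h)
      then show ?case using actT by (auto simp: T_def)
    next
      case (eng h1 h2)
      then have "h1 \<in> carrier G" "h2 \<in> carrier G" using S by auto
      then show ?case using eng sub Umult by auto
    qed
  qed
  have zeroK: "\<zero> \<in> K"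
  proof -
    have "u 0 \<oplus> (-1) \<odot> u 0 \<in> K" using addK smultK uD DK by blast
    then show ?thesis using u by (simp add: smult_m1 M.r_neg)
  qed
  have limK: "x \<in> K" if f: "\<And>n::nat. f n \<in> K" and x: "x \<in> carrier H"
    and lim: "(\<lambda>n. hnorm H (f n \<ominus> x)) \<longlonglongrightarrow> 0" for f x
  proof -
    have "\<exists>z\<in>D. hnorm H (z \<ominus> x) < e" if e: "e > 0" for e
    proof -
      have "eventually (\<lambda>n. hnorm H (f n \<ominus> x) < e/2) sequentially"
        using lim e by (intro order_tendstoD) auto
      then obtain n where n: "hnorm H (f n \<ominus> x) < e/2" by (auto simp: eventually_sequentially)
      obtain y where y: "y \<in> D" "y \<in> carrier H" "hnorm H (y \<ominus> f n) < e/2"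
        using KE[OF f, of "e/2" n] e by auto
      have "f n \<in> carrier H" using f sub by auto
      then have "hnorm H (y \<ominus> x) < e" using hnorm_diff_triangle[of y "f n" x] x y n by simp
      then show ?thesis using y by blast
    qed
    then show ?thesis using x by (auto simp: K_def)
  qed
  define e where "e = from_nat_into D"
  define \<phi> :: "'h \<Rightarrow> nat \<Rightarrow> complex"
    where "\<phi> x n = of_nat (SOME i. e i \<in> carrier H \<and> hnorm H (e i \<ominus> x) < 1 / real (Suc n))" for x n
  have "inj_on \<phi> K"
  proof (rule inj_onI)
    fix x y assume xy: "x \<in> K" "y \<in> K" "\<phi> x = \<phi> y"
    then have xyH: "x \<in> carrier H" "y \<in> carrier H" using sub by auto
    have small: "hnorm H (x \<ominus> y) < 2 * (1 / real (Suc n))" for n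
    proof -
      define i where "i z = (SOME i. e i \<in> carrier H \<and> hnorm H (e i \<ominus> z) < 1 / real (Suc n))" for z
      have i: "e (i z) \<in> carrier H \<and> hnorm H (e (i z) \<ominus> z) < 1 / real (Suc n)" if z: "z \<in> K" for z
      proof -
        obtain w where w: "w \<in> D" "w \<in> carrier H" "hnorm H (w \<ominus> z) < 1 / real (Suc n)"
          using KE[OF z, of "1 / real (Suc n)"] by auto
        then obtain j where "e j = w"
          using from_nat_into_surj[OF countable w(1)] by (auto simp: e_def)
        with w have "e j \<in> carrier H \<and> hnorm H (e j \<ominus> z) < 1 / real (Suc n)" by simp
        then show ?thesis unfolding i_def by (rule someI)
      qed
      have "(of_nat (i x) :: complex) = of_nat (i y)"
        using fun_cong[OF xy(3), of n] unfolding \<phi>_def i_def .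
      then have "i x = i y" by simp
      then show ?thesis
        using i[OF xy(1)] i[OF xy(2)] xyH hnorm_diff_triangle[of x "e (i x)" y]
          hnorm_minus_commute[of x "e (i x)"] by simp
    qed
    have "hnorm H (x \<ominus> y) \<le> 0"
    proof (rule field_le_epsilon)
      fix r :: real assume "r > 0"
      then obtain n where "1 / real (Suc n) < r / 2"
        using nat_approx_posE[of "r/2"] by auto
      then show "hnorm H (x \<ominus> y) \<le> 0 + r" using small[of n] by simp
    qed
    then have "x \<ominus> y = \<zero>"
      using hnorm_nonneg[of "x \<ominus> y"] hnorm_eq_0[of "x \<ominus> y"] xyH by simp
    then have "x \<oplus> \<ominus> y = \<zero>" by (simp add: a_minus_def)
    then have "\<ominus> (\<ominus> y) = x" using xyH by (intro M.minus_equality) simp_all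
    then show "x = y" using xyH by simp
  qed
  then have "transported_hilbert_space_axioms H K \<phi>"
    using sub zeroK addK smultK limK by (rule transported_hilbert_space_axioms.intro)
  then have "transported_hilbert_space H K \<phi>"
    by (rule transported_hilbert_space.intro[OF hilbert_space_axioms])
  then show ?thesis using that uD DK actK by blast
qed

theorem property_T_imp_property_T_on:
  assumes "property_T G S"
  shows "property_T_on TYPE('h) G S"
  unfolding property_T_on_def
proof (intro conjI allI impI)
  have P: "property_T_on TYPE(nat \<Rightarrow> complex) G S" using assms by (simp add: property_T_def)
  then show G: "group G" and S: "finite S" "S \<subseteq> carrier G" "generate G S = carrier G"
    by (auto simp: property_T_on_def)
  interpret G: group G by (rule G)
  fix H :: "'h hilbert" and \<pi>
  assume "hilbert_space H \<and> \<pi> \<in> hom G (unitary_group H) \<and> almost_invariant_vectors S H \<pi>"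
  then have H: "hilbert_space H" and hom: "\<pi> \<in> hom G (unitary_group H)"
    and ai: "almost_invariant_vectors S H \<pi>" by auto
  have "\<exists>u\<in>carrier H. \<forall>s\<in>S. hnorm H (\<pi> s u \<ominus>\<^bsub>H\<^esub> u) < 1 / real (Suc m) * hnorm H u" for m
    using ai unfolding almost_invariant_vectors_def by (elim allE[of _ "1 / real (Suc m)"]) simp
  then obtain u where u: "\<And>m. u m \<in> carrier H"
    "\<And>m s. s \<in> S \<Longrightarrow> hnorm H (\<pi> s (u m) \<ominus>\<^bsub>H\<^esub> u m) < 1 / real (Suc m) * hnorm H (u m)" by metis
  obtain K and \<phi> :: "'h \<Rightarrow> nat \<Rightarrow> complex" where tr: "transported_hilbert_space H K \<phi>"
    and uK: "\<And>m. u m \<in> K" and act: "\<And>g x. g \<in> carrier G \<Longrightarrow> x \<in> K \<Longrightarrow> \<pi> g x \<in> K"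
    using hilbert_space.separable_invariant_subspace[OF H G S hom, of u] u(1) by blast
  interpret transported_hilbert_space H K \<phi> by (rule tr)
  define \<rho> where "\<rho> g = (\<lambda>z\<in>\<phi> ` K. \<phi> (\<pi> g (inv_into K \<phi> z)))" for g
  have \<rho>: "\<rho> g (\<phi> x) = \<phi> (\<pi> g x)" if "x \<in> K" for g x
    using that inj by (simp add: \<rho>_def)
  have U: "\<pi> g \<in> carrier (unitary_group H)" if "g \<in> carrier G" for g
    using hom that by (auto simp: hom_def)
  have Umult: "\<pi> (g \<otimes>\<^bsub>G\<^esub> h) x = \<pi> g (\<pi> h x)"
    if "g \<in> carrier G" "h \<in> carrier G" "x \<in> K" for g h x
  proof -
    have "\<pi> g \<in> Bij (carrier H)" "\<pi> h \<in> Bij (carrier H)"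
      using U that by (auto simp: unitary_group_def)
    moreover have "x \<in> carrier H" using that sub by auto
    ultimately show ?thesis
      using hom that by (simp add: hom_def unitary_group_def BijGroup_def compose_eq)
  qed
  have Uinj: "inj_on (\<pi> g) K" if "g \<in> carrier G" for g
    using U[OF that] sub by (auto simp: unitary_group_def Bij_def bij_betw_def intro: inj_on_subset)
  have Uone: "\<pi> \<one>\<^bsub>G\<^esub> x = x" if "x \<in> K" for x
  proof -
    have "\<pi> \<one>\<^bsub>G\<^esub> (\<pi> \<one>\<^bsub>G\<^esub> x) = \<pi> \<one>\<^bsub>G\<^esub> x"
      using Umult[OF G.one_closed G.one_closed that] G.l_one[OF G.one_closed] by metis
    with Uinj[OF G.one_closed] show ?thesis
      using act[OF G.one_closed that] that by (rule inj_onD)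
  qed
  have \<rho>Bij: "\<rho> g \<in> Bij (\<phi> ` K)" if g: "g \<in> carrier G" for g
  proof -
    have "bij_betw (\<rho> g) (\<phi> ` K) (\<phi> ` K)"
    proof (rule bij_betw_byWitness[where f' = "\<rho> (inv\<^bsub>G\<^esub> g)"])
      show "\<forall>a\<in>\<phi> ` K. \<rho> (inv\<^bsub>G\<^esub> g) (\<rho> g a) = a" "\<forall>a\<in>\<phi> ` K. \<rho> g (\<rho> (inv\<^bsub>G\<^esub> g) a) = a"
        using g act Uone by (auto simp: \<rho> Umult[symmetric])
      show "\<rho> g ` \<phi> ` K \<subseteq> \<phi> ` K" "\<rho> (inv\<^bsub>G\<^esub> g) ` \<phi> ` K \<subseteq> \<phi> ` K"
        using g act by (auto simp: \<rho>)
    qed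
    then show ?thesis by (simp add: Bij_def \<rho>_def)
  qed
  have lin: "\<pi> g (x \<oplus>\<^bsub>H\<^esub> y) = \<pi> g x \<oplus>\<^bsub>H\<^esub> \<pi> g y" "\<pi> g (a \<odot>\<^bsub>H\<^esub> x) = a \<odot>\<^bsub>H\<^esub> \<pi> g x"
    "inner_prod H (\<pi> g x) (\<pi> g y) = inner_prod H x y"
    if "g \<in> carrier G" "x \<in> K" "y \<in> K" for g x y a
    using U[OF that(1)] subsetD[OF sub that(2)] subsetD[OF sub that(3)]
    by (auto simp: unitary_group_def)
  have \<rho>U: "\<rho> g \<in> carrier (unitary_group H')" if g: "g \<in> carrier G" for g
    using \<rho>Bij[OF g] g by (auto simp: unitary_group_def transport_simps \<rho> lin act add_K smult_K)
  have "\<rho> \<in> hom G (unitary_group H')"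
  proof (rule homI)
    fix g h assume g: "g \<in> carrier G" and h: "h \<in> carrier G"
    have "\<rho> (g \<otimes>\<^bsub>G\<^esub> h) = compose (\<phi> ` K) (\<rho> g) (\<rho> h)"
    proof (rule extensionalityI[where A = "\<phi> ` K"])
      fix z assume "z \<in> \<phi> ` K"
      then show "\<rho> (g \<otimes>\<^bsub>G\<^esub> h) z = compose (\<phi> ` K) (\<rho> g) (\<rho> h) z"
        using g h by (auto simp: compose_eq \<rho> Umult act)
    qed (simp_all add: \<rho>_def compose_def)
    then show "\<rho> (g \<otimes>\<^bsub>G\<^esub> h) = \<rho> g \<otimes>\<^bsub>unitary_group H'\<^esub> \<rho> h"
      using \<rho>Bij[OF g] \<rho>Bij[OF h] by (simp add: unitary_group_def BijGroup_def transport_simps)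
  qed (rule \<rho>U)
  moreover have "almost_invariant_vectors S H' \<rho>"
    unfolding almost_invariant_vectors_def
  proof (intro allI impI)
    fix \<epsilon> :: real assume "\<epsilon> > 0"
    then obtain m where m: "1 / real (Suc m) < \<epsilon>" by (rule nat_approx_posE)
    have "hnorm H' (\<rho> s (\<phi> (u m)) \<ominus>\<^bsub>H'\<^esub> \<phi> (u m)) < \<epsilon> * hnorm H' (\<phi> (u m))" if s: "s \<in> S" for s
    proof -
      have sG: "s \<in> carrier G" using s S by auto
      have "1 / real (Suc m) * hnorm H (u m) \<le> \<epsilon> * hnorm H (u m)"
        using m hnorm_nonneg[OF u(1)] by (intro mult_right_mono) auto
      then have "hnorm H (\<pi> s (u m) \<ominus>\<^bsub>H\<^esub> u m) < \<epsilon> * hnorm H (u m)" using u(2)[OF s, of m] by simp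
      then show ?thesis using uK act[OF sG] minus_K by (simp add: \<rho> transport_minus transport_simps)
    qed
    then show "\<exists>v\<in>carrier H'. \<forall>s\<in>S. hnorm H' (\<rho> s v \<ominus>\<^bsub>H'\<^esub> v) < \<epsilon> * hnorm H' v"
      using uK by (auto simp: transport_simps)
  qed
  ultimately have "\<exists>v\<in>carrier H'. v \<noteq> \<zero>\<^bsub>H'\<^esub> \<and> (\<forall>g\<in>carrier G. \<rho> g v = v)"
    using P hilbert_space_transport unfolding property_T_on_def by blast
  then obtain x where x: "x \<in> K" "\<phi> x \<noteq> \<phi> \<zero>\<^bsub>H\<^esub>" "\<And>g. g \<in> carrier G \<Longrightarrow> \<phi> (\<pi> g x) = \<phi> x"
    by (auto simp: transport_simps \<rho>)
  then have "\<pi> g x = x" if "g \<in> carrier G" for g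
    using that inj act by (meson inj_onD)
  then show "\<exists>v\<in>carrier H. v \<noteq> \<zero>\<^bsub>H\<^esub> \<and> (\<forall>g\<in>carrier G. \<pi> g v = v)"
    using x sub by (intro bexI[of _ x]) auto
qed

end

(*
  If f : G -> G' has image of finite index and G has (T), so does G': a unitary
  representation of G' with almost invariant vectors but no invariant vector would, after averaging
  over coset representatives, have almost f(G)-invariant vectors orthogonal to all f(G)-invariant
  ones. In particular (T) passes to quotients, so it is monotone in the set of relators, and the
  local LYM inequality makes the failure probability decrease with the number of relators.

  Reading each of N = n^j generators as a positive word of length j gives a homomorphism with image
  of finite index from a k-gonal group on N generators to a jk-gonal group on n generators, and
  (2N-1)^(kd) <= (2n-1)^(jkd); this settles the positive model. For the full model, a random set of
  relators at density d' contains, by Chebyshev, more positive words than a random positive set at a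
  smaller density, and the positive relators form a uniform set once their number is fixed.
*)
theory Submission
  imports Defs "HOL-Real_Asymp.Real_Asymp"
begin

section \<open>Random subsets\<close>

text \<open>Concatenating positive blocks never creates a cancellation, so for positive words the
  block substitution is a bijection from length k over n^j letters to length j*k over n letters, and
  relator sets correspond exactly. With inverse letters present, adjacent blocks can cancel. The
  full model is therefore reached only through the positive relators it happens to contain. These
  are at least a fraction 2^(-jk) of all cyclically reduced words; any drop in density absorbs this
  constant, and the interval (d0,1), open at d0, leaves room for such a drop.

  Monotonicity in the number of relators is needed already in the positive model, because
  (2N-1)^(kd) is in general smaller than (2n-1)^(jkd).

  In the finite-index argument the sum of the vectors c_i^(-1) u plays the part of a projection of
  u: if v is fixed by the image of f, the sum z of the c_i v is fixed by the whole group, hence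
  zero, and the inner product of the first sum with v equals that of u with z.

  Probabilities are handled as proportions of subsets, and most inequalities between proportions are
  first proved cross-multiplied in the natural numbers.\<close>

lemma sum_card_incidence:
  assumes "finite A" "finite B"
  shows "(\<Sum>a\<in>A. card {b\<in>B. r a b}) = (\<Sum>b\<in>B. card {a\<in>A. r a b})"
proof -
  have "(\<Sum>a\<in>A. card {b\<in>B. r a b}) = (\<Sum>a\<in>A. \<Sum>b\<in>B. if r a b then 1 else 0)"
    using assms by (simp add: sum.If_cases Int_def)
  also have "\<dots> = (\<Sum>b\<in>B. \<Sum>a\<in>A. if r a b then 1 else 0)"
    by (rule sum.swap)
  also have "\<dots> = (\<Sum>b\<in>B. card {a\<in>A. r a b})"
    using assms by (simp add: sum.If_cases Int_def)
  finally show ?thesis .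
qed

text \<open>\<open>R\<close> corresponds to the pair of \<open>R \<inter> P\<close> and
  \<open>R - P\<close>. The second factor does not involve \<open>B\<close>: once its size
  \<open>b\<close> is fixed, the trace on \<open>P\<close> is uniform among the
  \<open>b\<close>-subsets of \<open>P\<close>.\<close>

lemma card_subsets_by_trace:
  assumes "finite C" "P \<subseteq> C" "b \<le> m"
  shows "card {R. R \<subseteq> C \<and> card R = m \<and> card (R \<inter> P) = b \<and> B (R \<inter> P)} =
    card {Z. Z \<subseteq> P \<and> card Z = b \<and> B Z} * card {Y. Y \<subseteq> C - P \<and> card Y = m - b}"
proof -
  have fin: "finite P" using assms finite_subset by blast
  let ?Z = "{Z. Z \<subseteq> P \<and> card Z = b \<and> B Z}" and ?Y = "{Y. Y \<subseteq> C - P \<and> card Y = m - b}"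
  let ?R = "{R. R \<subseteq> C \<and> card R = m \<and> card (R \<inter> P) = b \<and> B (R \<inter> P)}"
  have "bij_betw (\<lambda>(Z, Y). Z \<union> Y) (?Z \<times> ?Y) ?R"
  proof (rule bij_betw_byWitness[where f' = "\<lambda>R. (R \<inter> P, R - P)"])
    show "\<forall>a\<in>?Z \<times> ?Y. (\<lambda>R. (R \<inter> P, R - P)) ((\<lambda>(Z, Y). Z \<union> Y) a) = a" by auto
    show "\<forall>R\<in>?R. (\<lambda>(Z, Y). Z \<union> Y) (R \<inter> P, R - P) = R" by auto
    show "(\<lambda>(Z, Y). Z \<union> Y) ` (?Z \<times> ?Y) \<subseteq> ?R"
    proof (rule image_subsetI, clarsimp)
      fix Z Y assume *: "Z \<subseteq> P" "b = card Z" "B Z" "Y \<subseteq> C - P" "card Y = m - card Z"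
      then have "(Z \<union> Y) \<inter> P = Z" "Z \<inter> Y = {}" by auto
      moreover have "finite Z" "finite Y" using * assms fin finite_subset by blast+
      ultimately show "Z \<subseteq> C \<and> Y \<subseteq> C \<and> card (Z \<union> Y) = m \<and> card ((Z \<union> Y) \<inter> P) = card Z \<and> B ((Z \<union> Y) \<inter> P)"
        using * assms by (auto simp: card_Un_disjoint)
    qed
    show "(\<lambda>R. (R \<inter> P, R - P)) ` ?R \<subseteq> ?Z \<times> ?Y"
    proof clarify
      fix R assume *: "R \<subseteq> C" "m = card R" "b = card (R \<inter> P)" "B (R \<inter> P)"
      have "card (R - P) = card R - card (R \<inter> P)"
        using * assms by (metis card_Diff_subset_Int finite_Int finite_subset)
      then show "R \<inter> P \<in> {Z. Z \<subseteq> P \<and> card Z = card (R \<inter> P) \<and> B Z} \<and> R - P \<in> {Y. Y \<subseteq> C - P \<and> card Y = card R - card (R \<inter> P)}"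
        using * by auto
    qed
  qed
  from bij_betw_same_card[OF this] show ?thesis by (simp add: card_cartesian_product)
qed

text \<open>This is \<open>card_subsets_by_trace\<close> with \<open>Q\<close> as the traced set and
  the trace forced to be all of \<open>Q\<close>; only the points outside \<open>Q\<close> are left
  to choose.\<close>

lemma card_supersets:
  assumes "finite P" "Q \<subseteq> P" "card Q \<le> b"
  shows "card {Z. Z \<subseteq> P \<and> card Z = b \<and> Q \<subseteq> Z} = (card P - card Q) choose (b - card Q)"
proof -
  have fin: "finite Q" using assms finite_subset by blast
  have "{Z. Z \<subseteq> P \<and> card Z = b \<and> Q \<subseteq> Z} =
      {R. R \<subseteq> P \<and> card R = b \<and> card (R \<inter> Q) = card Q \<and> R \<inter> Q = Q}" by (auto simp: Int_absorb1)
  moreover have "{Z. Z \<subseteq> Q \<and> card Z = card Q \<and> Z = Q} = {Q}" by auto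
  ultimately show ?thesis
    using card_subsets_by_trace[OF assms, of "\<lambda>Z. Z = Q"] assms fin
    by (simp add: n_subsets card_Diff_subset)
qed

text \<open>The local LYM inequality for the complement of an up-set.\<close>

lemma card_downset_levels:
  assumes P: "finite P" and le: "a \<le> b"
    and down: "\<And>Q Z. Q \<subseteq> Z \<Longrightarrow> Z \<subseteq> P \<Longrightarrow> B Z \<Longrightarrow> B Q"
  shows "card {Z. Z \<subseteq> P \<and> card Z = b \<and> B Z} * (card P choose a) \<le>
    card {Q. Q \<subseteq> P \<and> card Q = a \<and> B Q} * (card P choose b)"
proof (cases "b \<le> card P")
  case False
  then have "{Z. Z \<subseteq> P \<and> card Z = b \<and> B Z} = {}" using card_mono[OF P] by blast
  then show ?thesis by (simp only: card.empty mult_zero_left)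
next
  case True
  let ?Ba = "{Q. Q \<subseteq> P \<and> card Q = a \<and> B Q}" and ?Bb = "{Z. Z \<subseteq> P \<and> card Z = b \<and> B Z}"
  have fin: "finite ?Ba" "finite ?Bb" using P by (auto intro: finite_subset[of _ "Pow P"])
  \<comment> \<open>Double counting of pairs \<open>Q \<subseteq> Z\<close>: all
    \<open>a\<close>-subsets of a \<open>Z\<close> in \<open>?Bb\<close> satisfy \<open>B\<close>,
    whereas the supersets of a given \<open>Q\<close> in \<open>?Bb\<close> are only bounded by the
    number of all its \<open>b\<close>-supersets.\<close>
  have "card ?Bb * (b choose a) = (\<Sum>Z\<in>?Bb. card {Q\<in>?Ba. Q \<subseteq> Z})"
  proof -
    have "card {Q\<in>?Ba. Q \<subseteq> Z} = b choose a" if "Z \<in> ?Bb" for Z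
    proof -
      have "{Q\<in>?Ba. Q \<subseteq> Z} = {Q. Q \<subseteq> Z \<and> card Q = a}" using that down by auto
      moreover have "finite Z" "card Z = b" using that P finite_subset by auto
      ultimately show ?thesis by (simp add: n_subsets)
    qed
    then show ?thesis by simp
  qed
  also have "\<dots> = (\<Sum>Q\<in>?Ba. card {Z\<in>?Bb. Q \<subseteq> Z})"
    using fin by (intro sum_card_incidence)
  also have "\<dots> \<le> (\<Sum>Q\<in>?Ba. (card P - a) choose (b - a))"
  proof (rule sum_mono)
    fix Q assume Q: "Q \<in> ?Ba"
    have "card {Z\<in>?Bb. Q \<subseteq> Z} \<le> card {Z. Z \<subseteq> P \<and> card Z = b \<and> Q \<subseteq> Z}"
      using P by (intro card_mono) (auto intro: finite_subset[of _ "Pow P"])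
    then show "card {Z\<in>?Bb. Q \<subseteq> Z} \<le> (card P - a) choose (b - a)"
      using card_supersets[of P Q b] P Q le by simp
  qed
  finally have "card ?Bb * (b choose a) \<le> card ?Ba * ((card P - a) choose (b - a))" by simp
  \<comment> \<open>The factor \<open>card P choose a\<close> makes \<open>choose_mult\<close>
    applicable on the right, after which the positive factor \<open>b choose a\<close>
    cancels.\<close>
  then have "(card ?Bb * (b choose a)) * (card P choose a)
      \<le> (card ?Ba * ((card P - a) choose (b - a))) * (card P choose a)"
    by (rule mult_right_mono) simp
  also have "\<dots> = (card ?Ba * (card P choose b)) * (b choose a)"
    using choose_mult[OF le True] by (simp add: mult.commute mult.left_commute)
  finally have "(card ?Bb * (card P choose a)) * (b choose a) \<le> (card ?Ba * (card P choose b)) * (b choose a)"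
    by (simp add: mult.commute mult.left_commute)
  then show ?thesis using le by (simp add: zero_less_binomial)
qed

text \<open>Conditioned on a trace of size \<open>b \<ge> a\<close>, the proportion of traces in
  \<open>B\<close> is at most the proportion at level \<open>a\<close>; summing over
  \<open>b\<close> keeps that bound. The product form remains meaningful for
  \<open>b > card P\<close>, where the proportion would have denominator zero.\<close>

lemma card_downset_trace:
  assumes C: "finite C" and P: "P \<subseteq> C"
    and down: "\<And>Q Z. Q \<subseteq> Z \<Longrightarrow> Z \<subseteq> P \<Longrightarrow> B Z \<Longrightarrow> B Q"
  shows "card {R. R \<subseteq> C \<and> card R = m \<and> a \<le> card (R \<inter> P) \<and> B (R \<inter> P)} * (card P choose a) \<le>
    card {Q. Q \<subseteq> P \<and> card Q = a \<and> B Q} * (card C choose m)"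
proof -
  have fP: "finite P" using C P finite_subset by blast
  have finR: "finite {R. R \<subseteq> C \<and> K R}" for K
    using C by (auto intro: finite_subset[of _ "Pow C"])
  define t where "t b = card {Y. Y \<subseteq> C - P \<and> card Y = m - b}" for b
  define bad where "bad b = card {Z. Z \<subseteq> P \<and> card Z = b \<and> B Z}" for b
  have split: "card {R. R \<subseteq> C \<and> card R = m \<and> a \<le> card (R \<inter> P) \<and> D (R \<inter> P)} =
      (\<Sum>b\<in>{a..m}. card {Z. Z \<subseteq> P \<and> card Z = b \<and> D Z} * t b)" for D
  proof -
    have "card (R \<inter> P) \<le> card R" if "R \<subseteq> C" for R
      using that C by (intro card_mono) (auto intro: finite_subset)
    then have "{R. R \<subseteq> C \<and> card R = m \<and> a \<le> card (R \<inter> P) \<and> D (R \<inter> P)} =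
       (\<Union>b\<in>{a..m}. {R. R \<subseteq> C \<and> card R = m \<and> card (R \<inter> P) = b \<and> D (R \<inter> P)})" by auto
    also have "card \<dots> = (\<Sum>b\<in>{a..m}. card {R. R \<subseteq> C \<and> card R = m \<and> card (R \<inter> P) = b \<and> D (R \<inter> P)})"
      using finR by (intro card_UN_disjoint) auto
    also have "\<dots> = (\<Sum>b\<in>{a..m}. card {Z. Z \<subseteq> P \<and> card Z = b \<and> D Z} * t b)"
      unfolding t_def by (intro sum.cong refl card_subsets_by_trace[OF C P]) auto
    finally show ?thesis .
  qed
  have "card {R. R \<subseteq> C \<and> card R = m \<and> a \<le> card (R \<inter> P) \<and> B (R \<inter> P)} * (card P choose a)
      = (\<Sum>b\<in>{a..m}. (bad b * (card P choose a)) * t b)"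
    unfolding split bad_def sum_distrib_right by (intro sum.cong refl) (simp only: mult_ac)
  also have "\<dots> \<le> (\<Sum>b\<in>{a..m}. (bad a * (card P choose b)) * t b)"
    unfolding bad_def by (intro sum_mono mult_right_mono card_downset_levels[OF fP _ down]) auto
  also have "\<dots> = bad a * (\<Sum>b\<in>{a..m}. (card P choose b) * t b)"
    unfolding sum_distrib_left by (intro sum.cong refl) (simp only: mult_ac)
  \<comment> \<open>\<open>split\<close> holds for every predicate; with the trivial one it
    reassembles the levels into a single count.\<close>
  also have "(\<Sum>b\<in>{a..m}. (card P choose b) * t b) =
      card {R. R \<subseteq> C \<and> card R = m \<and> a \<le> card (R \<inter> P)}"
    using split[of "\<lambda>_. True"] by (simp add: n_subsets[OF fP])
  also have "bad a * \<dots> \<le> bad a * card {R. R \<subseteq> C \<and> card R = m}"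
    using finR by (intro mult_left_mono card_mono) auto
  finally show ?thesis by (simp add: bad_def n_subsets[OF C])
qed

text \<open>Chebyshev's inequality for the hypergeometric distribution, whose variance is at most its mean.\<close>

lemma card_small_trace:
  fixes \<mu> :: real
  assumes C: "finite C" and P: "P \<subseteq> C" and ne: "P \<noteq> {}" and m: "m \<le> card C" "0 < m"
    and \<mu>: "\<mu> = real (card P) * real m / real (card C)" and a: "2 * real a \<le> \<mu>"
  shows "real (card {R. R \<subseteq> C \<and> card R = m \<and> card (R \<inter> P) < a}) \<le> 4 / \<mu> * real (card C choose m)"
proof -
  define p where "p = card P"
  define c where "c = card C"
  have fP: "finite P" using C P finite_subset by blast
  have p0: "p > 0" using fP ne by (simp add: p_def card_gt_0_iff)
  have pc: "p \<le> c" using card_mono[OF C P] by (simp add: p_def c_def)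
  define M where "M = {R. R \<subseteq> C \<and> card R = m}"
  have fM: "finite M" using C by (auto simp: M_def intro: finite_subset[of _ "Pow C"])
  define T where "T = real (c choose m)"
  have cardM: "real (card M) = T" using C by (simp add: M_def T_def c_def n_subsets)
  have \<mu>0: "\<mu> > 0" using p0 pc m by (simp add: \<mu> p_def c_def)
  define tr where "tr R = real (card (R \<inter> P))" for R
  have one: "real (card {R\<in>M. x \<in> R}) = T * m / c" if "x \<in> P" for x
  proof -
    have "{R\<in>M. x \<in> R} = {R. R \<subseteq> C \<and> card R = m \<and> {x} \<subseteq> R}" by (auto simp: M_def)
    then have "card {R\<in>M. x \<in> R} = (c - 1) choose (m - 1)"
      using card_supersets[OF C, of "{x}" m] that P m by (auto simp: c_def)
    moreover have "m * (c choose m) = c * ((c - 1) choose (m - 1))"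
      using m by (intro times_binomial_minus1_eq) auto
    then have "real m * T = real c * real ((c - 1) choose (m - 1))"
      unfolding T_def by (metis of_nat_mult)
    ultimately show ?thesis using p0 pc by (simp add: field_simps)
  qed
  \<comment> \<open>Membership of two distinct points is negatively correlated: the exact proportion
    is (m/c)((m-1)/(c-1)), and (m-1)/(c-1) is at most m/c. The case \<open>m < 2\<close> is separate
    because \<open>m - 2\<close> truncates; the count is then zero.\<close>
  have two: "real (card {R\<in>M. x \<in> R \<and> y \<in> R}) \<le> T * (m / c) * (m / c)" (is "?l \<le> _")
    if xy: "x \<in> P" "y \<in> P" "x \<noteq> y" for x y
  proof -
    have eq: "{R\<in>M. x \<in> R \<and> y \<in> R} = {R. R \<subseteq> C \<and> card R = m \<and> {x, y} \<subseteq> R}" by (auto simp: M_def)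
    have c2: "2 \<le> c"
      using card_mono[OF C, of "{x, y}"] xy P by (auto simp: c_def numeral_2_eq_2)
    show ?thesis
    proof (cases "m \<ge> 2")
      case False
      have "card {x, y} \<le> card R" if "{x, y} \<subseteq> R" "R \<subseteq> C" for R
        using that C by (intro card_mono) (auto intro: finite_subset)
      with False xy(3) have "{R. R \<subseteq> C \<and> card R = m \<and> {x, y} \<subseteq> R} = {}" by fastforce
      then have "?l = 0" unfolding eq by (simp only: card.empty of_nat_0)
      then show ?thesis by (simp add: T_def)
    next
      case True
      have *: "card {R\<in>M. x \<in> R \<and> y \<in> R} = (c - 2) choose (m - 2)"
        using card_supersets[OF C, of "{x, y}" m] xy P True unfolding eq by (auto simp: c_def numeral_2_eq_2)
      have "m * (c choose m) = c * ((c - 1) choose (m - 1))"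
        using m by (intro times_binomial_minus1_eq) auto
      moreover have "(m - 1) * ((c - 1) choose (m - 1)) = (c - 1) * ((c - 1 - 1) choose (m - 1 - 1))"
        using True by (intro times_binomial_minus1_eq) auto
      moreover have "c - 1 - 1 = c - 2" "m - 1 - 1 = m - 2" by auto
      ultimately have "(m - 1) * (m * (c choose m)) = c * ((c - 1) * ((c - 2) choose (m - 2)))"
        by (metis mult.left_commute)
      then have "real (m - 1) * (real m * T) = real c * (real (c - 1) * ?l)"
        unfolding T_def * by (metis of_nat_mult)
      then have l: "?l = T * (m / c) * (real (m - 1) / real (c - 1))"
        using c2 by (simp add: field_simps)
      have "real (m - 1) / real (c - 1) \<le> m / c"
        using c2 True m by (simp add: c_def[symmetric] of_nat_diff field_simps)
      then show ?thesis unfolding l by (intro mult_left_mono) (auto simp: T_def)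
    qed
  qed
  have S1: "(\<Sum>R\<in>M. tr R) = \<mu> * T"
  proof -
    have "(\<Sum>R\<in>M. card {x\<in>P. x \<in> R}) = (\<Sum>x\<in>P. card {R\<in>M. x \<in> R})"
      by (rule sum_card_incidence[OF fM fP])
    moreover have "{x\<in>P. x \<in> R} = R \<inter> P" for R by auto
    ultimately have "(\<Sum>R\<in>M. card (R \<inter> P)) = (\<Sum>x\<in>P. card {R\<in>M. x \<in> R})" by simp
    then have "real (\<Sum>R\<in>M. card (R \<inter> P)) = real (\<Sum>x\<in>P. card {R\<in>M. x \<in> R})" by simp
    then show ?thesis using one by (simp add: tr_def \<mu> p_def c_def)
  qed
  have S2: "(\<Sum>R\<in>M. (tr R)\<^sup>2) \<le> \<mu> * T + \<mu>\<^sup>2 * T"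
  proof -
    have "(\<Sum>R\<in>M. card {z\<in>P \<times> P. fst z \<in> R \<and> snd z \<in> R}) = (\<Sum>z\<in>P \<times> P. card {R\<in>M. fst z \<in> R \<and> snd z \<in> R})"
      by (rule sum_card_incidence[OF fM]) (use fP in simp)
    moreover have "{z\<in>P \<times> P. fst z \<in> R \<and> snd z \<in> R} = (R \<inter> P) \<times> (R \<inter> P)" for R by auto
    ultimately have "(\<Sum>R\<in>M. card (R \<inter> P) * card (R \<inter> P)) =
        (\<Sum>z\<in>P \<times> P. card {R\<in>M. fst z \<in> R \<and> snd z \<in> R})"
      by (simp add: card_cartesian_product)
    then have "real (\<Sum>R\<in>M. card (R \<inter> P) * card (R \<inter> P)) =
        real (\<Sum>z\<in>P \<times> P. card {R\<in>M. fst z \<in> R \<and> snd z \<in> R})" by simp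
    then have "(\<Sum>R\<in>M. (tr R)\<^sup>2) = (\<Sum>z\<in>P \<times> P. real (card {R\<in>M. fst z \<in> R \<and> snd z \<in> R}))"
      by (simp add: tr_def power2_eq_square)
    also have "\<dots> = (\<Sum>x\<in>P. \<Sum>y\<in>P. real (card {R\<in>M. x \<in> R \<and> y \<in> R}))"
      by (simp add: sum.cartesian_product split_beta)
    \<comment> \<open>The product bound is kept on the diagonal as well. This adds a nonnegative
      amount and makes the double sum exactly \<open>\<mu> * T + \<mu>\<^sup>2 * T\<close>, so the
      variance is at most the mean.\<close>
    also have "\<dots> \<le> (\<Sum>x\<in>P. \<Sum>y\<in>P. (if x = y then T * m / c else 0) + T * (m / c) * (m / c))"
    proof (intro sum_mono)
      fix x y assume xy: "x \<in> P" "y \<in> P"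
      have "0 \<le> T * (m / c) * (m / c)" by (simp add: T_def)
      then show "real (card {R\<in>M. x \<in> R \<and> y \<in> R}) \<le>
          (if x = y then T * m / c else 0) + T * (m / c) * (m / c)"
        using one[of x] two[of x y] xy by (cases "x = y") auto
    qed
    also have "\<dots> = \<mu> * T + \<mu>\<^sup>2 * T"
      using fP by (simp add: sum.distrib \<mu> p_def c_def power2_eq_square algebra_simps)
    finally show ?thesis .
  qed
  have "(\<Sum>R\<in>M. (tr R - \<mu>)\<^sup>2) = (\<Sum>R\<in>M. (tr R)\<^sup>2) - 2 * \<mu> * (\<Sum>R\<in>M. tr R) + \<mu>\<^sup>2 * T"
    unfolding sum_distrib_left
    by (simp add: power2_diff sum.distrib sum_subtractf cardM mult_ac)
  also have "\<dots> \<le> \<mu> * T" using S2 by (simp add: S1 power2_eq_square algebra_simps)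
  finally have V: "(\<Sum>R\<in>M. (tr R - \<mu>)\<^sup>2) \<le> \<mu> * T" .
  let ?N = "{R. R \<subseteq> C \<and> card R = m \<and> card (R \<inter> P) < a}"
  \<comment> \<open>A trace below \<open>a \<le> \<mu> / 2\<close> deviates from the mean by at
    least \<open>\<mu> / 2\<close>; dividing the variance bound \<open>\<mu>\<close> by the square
    of this gives the constant \<open>4 / \<mu>\<close>.\<close>
  have "real (card ?N) * (\<mu> / 2)\<^sup>2 = (\<Sum>R\<in>?N. (\<mu> / 2)\<^sup>2)" by simp
  also have "\<dots> \<le> (\<Sum>R\<in>?N. (tr R - \<mu>)\<^sup>2)"
  proof (rule sum_mono)
    fix R assume "R \<in> ?N"
    then have "\<mu> / 2 \<le> \<mu> - tr R" using a by (simp add: tr_def)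
    then have "(\<mu> / 2)\<^sup>2 \<le> (\<mu> - tr R)\<^sup>2" using \<mu>0 by (intro power_mono) auto
    then show "(\<mu> / 2)\<^sup>2 \<le> (tr R - \<mu>)\<^sup>2" by (simp add: power2_commute)
  qed
  also have "\<dots> \<le> (\<Sum>R\<in>M. (tr R - \<mu>)\<^sup>2)"
    using fM by (intro sum_mono2) (auto simp: M_def)
  finally have "real (card ?N) * (\<mu> / 2)\<^sup>2 \<le> \<mu> * T" using V by simp
  then have "real (card ?N) \<le> 4 / \<mu> * T"
    using \<mu>0 by (simp add: field_simps power2_eq_square)
  then show ?thesis by (simp add: T_def c_def)
qed

section \<open>Property (T) and homomorphisms with image of finite index\<close>

locale unitary_representation = hilbert_space H + G: group G
  for H :: "'h hilbert" (structure) and G :: "('g, 'm) monoid_scheme" +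
  fixes \<pi> :: "'g \<Rightarrow> 'h \<Rightarrow> 'h"
  assumes hom: "\<pi> \<in> hom G (unitary_group H)"
begin

lemma act_unitary: "g \<in> carrier G \<Longrightarrow> \<pi> g \<in> carrier (unitary_group H)"
  using hom by (auto simp: hom_def)

lemma act_Bij: "g \<in> carrier G \<Longrightarrow> \<pi> g \<in> Bij (carrier H)"
  using act_unitary by (auto simp: unitary_group_def)

lemma act_closed [simp]: "g \<in> carrier G \<Longrightarrow> x \<in> carrier H \<Longrightarrow> \<pi> g x \<in> carrier H"
  using act_Bij by (auto dest: Bij_imp_funcset)

lemma act_add:
  "g \<in> carrier G \<Longrightarrow> x \<in> carrier H \<Longrightarrow> y \<in> carrier H \<Longrightarrow> \<pi> g (x \<oplus> y) = \<pi> g x \<oplus> \<pi> g y"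
  using act_unitary[of g] by (simp add: unitary_group_def)

lemma act_smult: "g \<in> carrier G \<Longrightarrow> x \<in> carrier H \<Longrightarrow> \<pi> g (a \<odot> x) = a \<odot> \<pi> g x"
  using act_unitary[of g] by (simp add: unitary_group_def)

lemma act_inner:
  "g \<in> carrier G \<Longrightarrow> x \<in> carrier H \<Longrightarrow> y \<in> carrier H \<Longrightarrow>
    inner_prod H (\<pi> g x) (\<pi> g y) = inner_prod H x y"
  using act_unitary[of g] by (simp add: unitary_group_def)

lemma act_mult:
  assumes "g \<in> carrier G" "h \<in> carrier G" "x \<in> carrier H"
  shows "\<pi> (g \<otimes>\<^bsub>G\<^esub> h) x = \<pi> g (\<pi> h x)"
  using hom assms act_Bij by (simp add: hom_def unitary_group_def BijGroup_def compose_eq)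

text \<open>Membership in \<open>hom\<close> gives only multiplicativity. The map of the unit is
  idempotent and injective, hence the identity.\<close>

lemma act_one:
  assumes x: "x \<in> carrier H" shows "\<pi> \<one>\<^bsub>G\<^esub> x = x"
proof -
  have "inj_on (\<pi> \<one>\<^bsub>G\<^esub>) (carrier H)"
    using act_Bij[OF G.one_closed] by (auto simp: Bij_def bij_betw_def)
  moreover have "\<pi> \<one>\<^bsub>G\<^esub> (\<pi> \<one>\<^bsub>G\<^esub> x) = \<pi> \<one>\<^bsub>G\<^esub> x"
    using act_mult[OF G.one_closed G.one_closed x] by simp
  ultimately show ?thesis by (rule inj_onD) (use x in simp_all)
qed

lemma act_minus:
  "g \<in> carrier G \<Longrightarrow> x \<in> carrier H \<Longrightarrow> y \<in> carrier H \<Longrightarrow> \<pi> g (x \<ominus> y) = \<pi> g x \<ominus> \<pi> g y"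
  unfolding a_minus_def by (simp add: act_add act_smult smult_m1[symmetric] smult_closed')

lemma act_hnorm: "g \<in> carrier G \<Longrightarrow> x \<in> carrier H \<Longrightarrow> hnorm H (\<pi> g x) = hnorm H x"
  by (simp add: hnorm_def act_inner)

lemma act_inv_act: "g \<in> carrier G \<Longrightarrow> x \<in> carrier H \<Longrightarrow> \<pi> g (\<pi> (inv\<^bsub>G\<^esub> g) x) = x"
  by (simp add: act_mult[symmetric] act_one)

lemma act_act_inv: "g \<in> carrier G \<Longrightarrow> x \<in> carrier H \<Longrightarrow> \<pi> (inv\<^bsub>G\<^esub> g) (\<pi> g x) = x"
  by (simp add: act_mult[symmetric] act_one)

lemma act_adjoint:
  assumes "g \<in> carrier G" "x \<in> carrier H" "y \<in> carrier H"
  shows "inner_prod H (\<pi> (inv\<^bsub>G\<^esub> g) x) y = inner_prod H x (\<pi> g y)"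
  using act_inner[of g "\<pi> (inv\<^bsub>G\<^esub> g) x" y] assms by (simp add: act_inv_act)

lemma act_zero: "g \<in> carrier G \<Longrightarrow> \<pi> g \<zero> = \<zero>"
  using act_hnorm[of g \<zero>] hnorm_eq_0[of "\<pi> g \<zero>"] by (simp add: hnorm_zero)

lemma act_finsum:
  assumes "finite I" "g \<in> carrier G" "u \<in> I \<rightarrow> carrier H"
  shows "\<pi> g (finsum H u I) = finsum H (\<lambda>i. \<pi> g (u i)) I"
  using assms by (induction I) (auto simp: act_zero act_add Pi_iff)

text \<open>\<open>L\<close> can be the length of an expression of \<open>g\<close> in the
  generators: the action is isometric, so displacements add along products and agree for
  \<open>s\<close> and its inverse. \<open>L\<close> is quantified before \<open>u\<close> and
  \<delta>, since \<delta> will later be chosen in terms of it.\<close>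

lemma displacement_bound:
  assumes S: "S \<subseteq> carrier G" and g: "g \<in> generate G S"
  shows "\<exists>L. \<forall>u\<in>carrier H. \<forall>\<delta>.
    (\<forall>s\<in>S. hnorm H (\<pi> s u \<ominus> u) \<le> \<delta>) \<longrightarrow> hnorm H (\<pi> g u \<ominus> u) \<le> L * \<delta>"
  using g
proof induction
  case one
  show ?case
    by (rule exI[of _ 0]) (auto simp: act_one a_minus_def M.r_neg hnorm_zero)
next
  case (incl s)
  then show ?case by (intro exI[of _ 1]) auto
next
  case (inv s)
  have s: "s \<in> carrier G" using inv S by auto
  have "hnorm H (\<pi> (inv\<^bsub>G\<^esub> s) u \<ominus> u) = hnorm H (\<pi> s u \<ominus> u)" if u: "u \<in> carrier H" for u
  proof -
    have "hnorm H (\<pi> (inv\<^bsub>G\<^esub> s) u \<ominus> u) = hnorm H (\<pi> s (\<pi> (inv\<^bsub>G\<^esub> s) u \<ominus> u))"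
      using s u by (simp add: act_hnorm)
    also have "\<dots> = hnorm H (u \<ominus> \<pi> s u)" using s u by (simp add: act_minus act_inv_act)
    finally show ?thesis using s u by (simp add: hnorm_minus_commute)
  qed
  then show ?case using inv by (intro exI[of _ 1]) auto
next
  case (eng g h)
  have gh: "g \<in> carrier G" "h \<in> carrier G" using eng.hyps G.generate_incl[OF S] by auto
  from eng.IH obtain L M where
    L: "\<And>u \<delta>. u \<in> carrier H \<Longrightarrow> (\<forall>s\<in>S. hnorm H (\<pi> s u \<ominus> u) \<le> \<delta>) \<Longrightarrow> hnorm H (\<pi> g u \<ominus> u) \<le> L * \<delta>" and
    M: "\<And>u \<delta>. u \<in> carrier H \<Longrightarrow> (\<forall>s\<in>S. hnorm H (\<pi> s u \<ominus> u) \<le> \<delta>) \<Longrightarrow> hnorm H (\<pi> h u \<ominus> u) \<le> M * \<delta>"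
    by blast
  have "hnorm H (\<pi> (g \<otimes>\<^bsub>G\<^esub> h) u \<ominus> u) \<le> (L + M) * \<delta>"
    if u: "u \<in> carrier H" and \<delta>: "\<forall>s\<in>S. hnorm H (\<pi> s u \<ominus> u) \<le> \<delta>" for u \<delta>
  proof -
    have "hnorm H (\<pi> (g \<otimes>\<^bsub>G\<^esub> h) u \<ominus> u) \<le> hnorm H (\<pi> g (\<pi> h u) \<ominus> \<pi> g u) + hnorm H (\<pi> g u \<ominus> u)"
      using gh u hnorm_diff_triangle[of "\<pi> g (\<pi> h u)" "\<pi> g u" u] by (simp add: act_mult)
    also have "hnorm H (\<pi> g (\<pi> h u) \<ominus> \<pi> g u) = hnorm H (\<pi> h u \<ominus> u)"
      using gh u by (simp add: act_minus[symmetric] act_hnorm)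
    finally show ?thesis using L[OF u \<delta>] M[OF u \<delta>] by (simp add: algebra_simps)
  qed
  then show ?case by blast
qed

text \<open>\<open>displacement_bound\<close> with \<delta> = 0 forces the displacement by
  \<open>g\<close> to vanish.\<close>

lemma invariant_if_generators_invariant:
  assumes S: "S \<subseteq> carrier G" "generate G S = carrier G" and x: "x \<in> carrier H"
    and inv: "\<And>s. s \<in> S \<Longrightarrow> \<pi> s x = x" and g: "g \<in> carrier G"
  shows "\<pi> g x = x"
proof -
  obtain L where "(\<forall>s\<in>S. hnorm H (\<pi> s x \<ominus> x) \<le> 0) \<longrightarrow> hnorm H (\<pi> g x \<ominus> x) \<le> L * 0"
    using displacement_bound[OF S(1), of g] S(2) g x by blast
  moreover have "\<forall>s\<in>S. hnorm H (\<pi> s x \<ominus> x) \<le> 0"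
    using inv x by (simp add: a_minus_def M.r_neg hnorm_zero)
  ultimately have "hnorm H (\<pi> g x \<ominus> x) = 0"
    using hnorm_nonneg[of "\<pi> g x \<ominus> x"] g x by simp
  then have "\<pi> g x \<oplus> \<ominus> x = \<zero>" using hnorm_eq_0[of "\<pi> g x \<ominus> x"] g x by (simp add: a_minus_def)
  then have "\<ominus> (\<ominus> x) = \<pi> g x" using g x by (intro M.minus_equality) simp_all
  then show ?thesis using x by simp
qed

end

section \<open>Finite sums of vectors\<close>

context hilbert_space
begin

lemma inner_finsum_left:
  assumes "finite I" "u \<in> I \<rightarrow> carrier H" "y \<in> carrier H"
  shows "inner_prod H (finsum H u I) y = (\<Sum>i\<in>I. inner_prod H (u i) y)"
  using assms by (induction I) (auto simp: inner_zero_left inner_add Pi_iff)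

lemma inner_finsum_right:
  assumes "finite I" "u \<in> I \<rightarrow> carrier H" "y \<in> carrier H"
  shows "inner_prod H y (finsum H u I) = (\<Sum>i\<in>I. inner_prod H y (u i))"
proof -
  have "finsum H u I \<in> carrier H" using assms by (intro M.finsum_closed)
  then have "inner_prod H y (finsum H u I) = (\<Sum>i\<in>I. cnj (inner_prod H (u i) y))"
    using inner_finsum_left[OF assms] inner_commute[of "finsum H u I" y] assms by simp
  also have "\<dots> = (\<Sum>i\<in>I. inner_prod H y (u i))"
    using assms by (intro sum.cong refl inner_commute[symmetric]) auto
  finally show ?thesis .
qed

lemma hnorm_finsum:
  assumes "finite I" "u \<in> I \<rightarrow> carrier H"
  shows "hnorm H (finsum H u I) \<le> (\<Sum>i\<in>I. hnorm H (u i))"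
  using assms
proof (induction I)
  case (insert i I)
  then show ?case using hnorm_triangle[of "u i" "finsum H u I"] by (auto simp: Pi_iff)
qed (simp add: hnorm_zero)

lemma finsum_minus:
  assumes "finite I" "u \<in> I \<rightarrow> carrier H" "v \<in> I \<rightarrow> carrier H"
  shows "finsum H u I \<ominus> finsum H v I = finsum H (\<lambda>i. u i \<ominus> v i) I"
  using assms
proof (induction I)
  case (insert i I)
  then show ?case by (simp add: Pi_iff a_minus_def M.minus_add M.a_ac)
qed (simp add: a_minus_def)

lemma finsum_const:
  assumes "finite I" "x \<in> carrier H"
  shows "finsum H (\<lambda>i. x) I = of_nat (card I) \<odot> x"
  using assms
proof (induction I)
  case empty
  have "(0::complex) \<odot> x = \<zero>"
    using smult_diff_left[OF empty, of 0 0] empty by (simp add: a_minus_def M.r_neg smult_closed')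
  then show ?case by simp
next
  case (insert i I)
  then show ?case by (simp add: smult_add_left smult_1)
qed

end

section \<open>Invariant vectors and their orthogonal complement\<close>

context unitary_representation
begin

definition fixed :: "'g set \<Rightarrow> 'h set" where
  "fixed K = {v \<in> carrier H. \<forall>k\<in>K. \<pi> k v = v}"

text \<open>The orthogonal complement of the \<open>K\<close>-invariant vectors. A
  \<open>K\<close>-invariant vector in it is orthogonal to itself, hence zero.\<close>

definition moved :: "'g set \<Rightarrow> 'h set" where
  "moved K = {w \<in> carrier H. \<forall>v\<in>fixed K. inner_prod H w v = 0}"

lemma fixed_smult: "K \<subseteq> carrier G \<Longrightarrow> v \<in> fixed K \<Longrightarrow> a \<odot> v \<in> fixed K"
  by (auto simp: fixed_def act_smult smult_closed' subset_iff)

text \<open>Transport along the identity map turns a closed subspace into a Hilbert space of its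
  own. The point with content is closedness under limits.\<close>

lemma transported_moved:
  assumes K: "K \<subseteq> carrier G"
  shows "transported_hilbert_space H (moved K) (\<lambda>x. x)"
proof
  show "\<zero> \<in> moved K" by (auto simp: moved_def fixed_def inner_zero_left)
  show "x \<oplus> y \<in> moved K" if "x \<in> moved K" "y \<in> moved K" for x y
    using that by (auto simp: moved_def fixed_def inner_add)
  show "a \<odot> x \<in> moved K" if "x \<in> moved K" for a x
    using that by (auto simp: moved_def fixed_def inner_smult smult_closed')
  fix f :: "nat \<Rightarrow> 'h" and x
  assume f: "\<And>n. f n \<in> moved K" and x: "x \<in> carrier H" and lim: "(\<lambda>n. hnorm H (f n \<ominus> x)) \<longlonglongrightarrow> 0"
  \<comment> \<open>\<open>Re_inner_le\<close> bounds only the real part, from above. As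
    \<open>fixed K\<close> is closed under scalars, replacing \<open>v\<close> by its multiples by
    1, -1, i and -i then makes both the real and the imaginary part vanish.\<close>
  have le: "Re (inner_prod H x v) \<le> 0" if v: "v \<in> fixed K" for v
  proof (rule LIMSEQ_le_const)
    show "(\<lambda>n. hnorm H (f n \<ominus> x) * hnorm H v) \<longlonglongrightarrow> 0" using tendsto_mult_left_zero[OF lim] by simp
    have vH: "v \<in> carrier H" using v by (simp add: fixed_def)
    have "Re (inner_prod H x v) \<le> hnorm H (f n \<ominus> x) * hnorm H v" for n
    proof -
      have fn: "f n \<in> carrier H" "inner_prod H (f n) v = 0" using f[of n] v by (auto simp: moved_def)
      then have "Re (inner_prod H x v) = Re (inner_prod H (x \<ominus> f n) v)"
        using x vH by (simp add: a_minus_def inner_add inner_neg)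
      also have "\<dots> \<le> hnorm H (x \<ominus> f n) * hnorm H v" using x fn vH by (intro Re_inner_le) simp_all
      finally show ?thesis using x fn by (simp add: hnorm_minus_commute)
    qed
    then show "\<exists>N. \<forall>n\<ge>N. Re (inner_prod H x v) \<le> hnorm H (f n \<ominus> x) * hnorm H v" by blast
  qed
  have "inner_prod H x v = 0" if v: "v \<in> fixed K" for v
  proof -
    have vH: "v \<in> carrier H" using v by (simp add: fixed_def)
    have "Re (cnj a * inner_prod H x v) \<le> 0" for a
      using le[OF fixed_smult[OF K v, of a]] x vH by (simp add: inner_smult_right)
    from this[of 1] this[of "-1"] this[of \<i>] this[of "-\<i>"] show ?thesis by (simp add: complex_eq_iff)
  qed
  then show "x \<in> moved K" using x by (auto simp: moved_def)
qed (auto simp: moved_def)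

text \<open>For \<open>v\<close> fixed by \<open>k\<close>, unitarity identifies the inner product
  of \<open>\<pi> k w\<close> and \<open>v\<close> with that of \<open>w\<close> and
  \<open>v\<close>.\<close>

lemma moved_act:
  assumes K: "subgroup K G" and k: "k \<in> K" and w: "w \<in> moved K"
  shows "\<pi> k w \<in> moved K"
proof -
  have kG: "k \<in> carrier G" using K k by (rule subgroup.mem_carrier)
  have "inner_prod H (\<pi> k w) v = 0" if v: "v \<in> fixed K" for v
    using act_inner[OF kG, of w v] v w k by (auto simp: fixed_def moved_def)
  then show ?thesis using w kG by (auto simp: moved_def)
qed

end

text \<open>Finite index is encoded without cosets: with \<open>K\<close> the image of
  \<open>f\<close>, \<open>perm\<close> says that \<open>s\<close> carries the coset of
  \<open>c i\<close> to that of \<open>c (\<sigma> s i)\<close>, so the finitely many cosets of the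
  \<open>c i\<close> are permuted by \<open>G\<close> and cover it. Representatives may repeat,
  because in a presented group one cannot tell whether two candidates lie in the same coset.\<close>

theorem property_T_finite_index_image:
  fixes G1 :: "('a, 'm) monoid_scheme" and G :: "('b, 'n) monoid_scheme"
  assumes T: "property_T G1 S1" and G: "group G"
    and S: "finite S" "S \<subseteq> carrier G" "generate G S = carrier G" "S \<noteq> {}"
    and f: "f \<in> hom G1 G"
    and I: "finite I" "I \<noteq> {}" and c: "\<And>i. i \<in> I \<Longrightarrow> c i \<in> carrier G"
    and \<sigma>: "\<And>s. s \<in> S \<Longrightarrow> bij_betw (\<sigma> s) I I"
    and perm: "\<And>s i. s \<in> S \<Longrightarrow> i \<in> I \<Longrightarrow>
      inv\<^bsub>G\<^esub> c (\<sigma> s i) \<otimes>\<^bsub>G\<^esub> (s \<otimes>\<^bsub>G\<^esub> c i) \<in> f ` carrier G1"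
  shows "property_T G S"
  unfolding property_T_def property_T_on_def
proof (intro conjI allI impI G S)
  fix H :: "(nat \<Rightarrow> complex) hilbert" and \<pi>
  assume "hilbert_space H \<and> \<pi> \<in> hom G (unitary_group H) \<and> almost_invariant_vectors S H \<pi>"
  then have H: "hilbert_space H" and hom: "\<pi> \<in> hom G (unitary_group H)"
    and ai: "almost_invariant_vectors S H \<pi>" by auto
  have T1: "property_T_on TYPE(nat \<Rightarrow> complex) G1 S1" using T by (simp add: property_T_def)
  then have G1: "group G1" and S1: "finite S1" "S1 \<subseteq> carrier G1"
    by (auto simp: property_T_on_def)
  interpret G: group G by (rule G)
  interpret G1: group G1 by (rule G1)
  interpret unitary_representation H G \<pi>
    by (intro unitary_representation.intro H G unitary_representation_axioms.intro hom)
  interpret f: group_hom G1 G f by (intro group_hom.intro G G1 group_hom_axioms.intro f)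
  define K where "K = f ` carrier G1"
  have K: "subgroup K G" unfolding K_def by (rule f.img_is_subgroup)
  have KG: "K \<subseteq> carrier G" using K by (rule subgroup.subset)
  show "\<exists>u\<in>carrier H. u \<noteq> \<zero>\<^bsub>H\<^esub> \<and> (\<forall>g\<in>carrier G. \<pi> g u = u)"
  proof (rule ccontr)
    assume contra: "\<not> ?thesis"
    define W where "W = moved K"
    interpret transported_hilbert_space H W "\<lambda>x. x"
      unfolding W_def by (rule transported_moved[OF KG])
    have WH: "w \<in> carrier H" if "w \<in> W" for w using that by (simp add: W_def moved_def)
    \<comment> \<open>The elements of \<open>Bij W\<close> are extensional functions, hence the
      restriction to \<open>W\<close>.\<close>
    define \<rho> where "\<rho> g = (\<lambda>w\<in>W. \<pi> (f g) w)" for g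
    have actW: "\<pi> (f g) w \<in> W" if "g \<in> carrier G1" "w \<in> W" for g w
      using that moved_act[OF K] by (auto simp: W_def K_def)
    have fG: "f g \<in> carrier G" if "g \<in> carrier G1" for g using that by simp
    have \<rho>Bij: "\<rho> g \<in> Bij W" if g: "g \<in> carrier G1" for g
    proof -
      have "bij_betw (\<rho> g) W W"
      proof (rule bij_betw_byWitness[where f' = "\<rho> (inv\<^bsub>G1\<^esub> g)"])
        show "\<forall>a\<in>W. \<rho> (inv\<^bsub>G1\<^esub> g) (\<rho> g a) = a" "\<forall>a\<in>W. \<rho> g (\<rho> (inv\<^bsub>G1\<^esub> g) a) = a"
          using g actW[of g] actW[of "inv\<^bsub>G1\<^esub> g"] WH by (auto simp: \<rho>_def act_inv_act act_act_inv)
        show "\<rho> g ` W \<subseteq> W" "\<rho> (inv\<^bsub>G1\<^esub> g) ` W \<subseteq> W"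
          using g actW[of g] actW[of "inv\<^bsub>G1\<^esub> g"] by (auto simp: \<rho>_def)
      qed
      then show ?thesis by (simp add: Bij_def \<rho>_def)
    qed
    have \<rho>hom: "\<rho> \<in> hom G1 (unitary_group H')"
    proof (rule homI)
      fix g assume g: "g \<in> carrier G1"
      show "\<rho> g \<in> carrier (unitary_group H')"
        using \<rho>Bij[OF g] g fG[OF g] actW WH add_K smult_K
        by (auto simp: unitary_group_def transport_simps \<rho>_def act_add act_smult act_inner)
    next
      fix g h assume g: "g \<in> carrier G1" and h: "h \<in> carrier G1"
      have "\<rho> (g \<otimes>\<^bsub>G1\<^esub> h) = compose W (\<rho> g) (\<rho> h)"
        using g h actW WH by (auto simp: \<rho>_def compose_def restrict_def act_mult)
      then show "\<rho> (g \<otimes>\<^bsub>G1\<^esub> h) = \<rho> g \<otimes>\<^bsub>unitary_group H'\<^esub> \<rho> h"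
        using \<rho>Bij[OF g] \<rho>Bij[OF h] by (simp add: unitary_group_def BijGroup_def transport_simps)
    qed
    \<comment> \<open>An unnormalised average: it lies exactly in \<open>W\<close>, and it stays
      close to \<open>card I\<close> times \<open>u\<close> when \<open>u\<close> is almost
      invariant. The inverses become the \<open>c i\<close> themselves when moved to the other side
      of the inner product.\<close>
    define y where "y u = finsum H (\<lambda>i. \<pi> (inv\<^bsub>G\<^esub> c i) u) I" for u
    \<comment> \<open>If \<open>v\<close> is fixed by \<open>K\<close>, then the sum of its translates by \<open>c\<close> is fixed by \<open>G\<close>, hence zero.\<close>
    have yW: "y u \<in> W" if u: "u \<in> carrier H" for u
    proof -
      have "inner_prod H (y u) v = 0" if v: "v \<in> fixed K" for v
      proof -
        have vH: "v \<in> carrier H" using v by (simp add: fixed_def)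
        define z where "z = finsum H (\<lambda>i. \<pi> (c i) v) I"
        have zH: "z \<in> carrier H" using c vH by (auto simp: z_def intro!: M.finsum_closed)
        have "\<pi> s z = z" if s: "s \<in> S" for s
        proof -
          have sG: "s \<in> carrier G" using s S by auto
          \<comment> \<open>Here \<open>s\<close> times \<open>c i\<close> is
            \<open>c (\<sigma> s i)\<close> times an element of \<open>K\<close>, which fixes
            \<open>v\<close>; so \<open>s\<close> only permutes the summands of
            \<open>z\<close>.\<close>
          have step: "\<pi> s (\<pi> (c i) v) = \<pi> (c (\<sigma> s i)) v" if i: "i \<in> I" for i
          proof -
            have i': "\<sigma> s i \<in> I" using \<sigma>[OF s] i by (auto simp: bij_betw_def)
            define k where "k = inv\<^bsub>G\<^esub> c (\<sigma> s i) \<otimes>\<^bsub>G\<^esub> (s \<otimes>\<^bsub>G\<^esub> c i)"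
            have "k \<in> K" using perm[OF s i] by (simp add: k_def K_def)
            then have kv: "\<pi> k v = v" "k \<in> carrier G" using v KG by (auto simp: fixed_def)
            have "s \<otimes>\<^bsub>G\<^esub> c i = c (\<sigma> s i) \<otimes>\<^bsub>G\<^esub> k"
              using c[OF i] c[OF i'] sG by (simp add: k_def G.m_assoc[symmetric])
            then have "\<pi> (s \<otimes>\<^bsub>G\<^esub> c i) v = \<pi> (c (\<sigma> s i) \<otimes>\<^bsub>G\<^esub> k) v" by simp
            then show ?thesis using c[OF i] c[OF i'] sG kv vH by (simp add: act_mult)
          qed
          have im: "\<sigma> s ` I = I" and inj\<sigma>: "inj_on (\<sigma> s) I" using \<sigma>[OF s] by (auto simp: bij_betw_def)
          have cv: "(\<lambda>i. \<pi> (c i) v) \<in> I \<rightarrow> carrier H" using c vH by auto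
          have "\<pi> s z = finsum H (\<lambda>i. \<pi> s (\<pi> (c i) v)) I"
            unfolding z_def using I(1) sG cv by (rule act_finsum)
          also have "\<dots> = finsum H (\<lambda>i. \<pi> (c (\<sigma> s i)) v) I"
            using im cv step by (intro M.finsum_cong' refl) (blast, simp)
          also have "\<dots> = finsum H (\<lambda>i. \<pi> (c i) v) (\<sigma> s ` I)"
            using cv inj\<sigma> by (intro M.finsum_reindex[symmetric]) (simp_all add: im)
          also have "\<sigma> s ` I = I" by (rule im)
          finally show ?thesis by (simp add: z_def)
        qed
        then have "\<forall>g\<in>carrier G. \<pi> g z = z"
          using invariant_if_generators_invariant[OF S(2,3) zH] by blast
        then have z0: "z = \<zero>\<^bsub>H\<^esub>" using contra zH by blast
        have "inner_prod H (y u) v = (\<Sum>i\<in>I. inner_prod H (\<pi> (inv\<^bsub>G\<^esub> c i) u) v)"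
          unfolding y_def using I c u vH by (intro inner_finsum_left) auto
        also have "\<dots> = (\<Sum>i\<in>I. inner_prod H u (\<pi> (c i) v))"
          using c u vH by (intro sum.cong) (auto simp: act_adjoint)
        also have "\<dots> = inner_prod H u z"
          unfolding z_def using I c u vH by (intro inner_finsum_right[symmetric]) auto
        also have "\<dots> = 0" using z0 u inner_commute[of "\<zero>\<^bsub>H\<^esub>" u] by (simp add: inner_zero_left)
        finally show ?thesis .
      qed
      moreover have "y u \<in> carrier H" unfolding y_def using c u by (auto intro!: M.finsum_closed)
      ultimately show ?thesis by (auto simp: W_def moved_def)
    qed
    have "\<forall>g\<in>carrier G. \<exists>L. \<forall>u\<in>carrier H. \<forall>\<delta>.
      (\<forall>s\<in>S. hnorm H (\<pi> s u \<ominus>\<^bsub>H\<^esub> u) \<le> \<delta>) \<longrightarrow> hnorm H (\<pi> g u \<ominus>\<^bsub>H\<^esub> u) \<le> L * \<delta>"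
      using displacement_bound[OF S(2)] S(3) by auto
    then obtain L where L: "\<And>g u \<delta>. g \<in> carrier G \<Longrightarrow> u \<in> carrier H \<Longrightarrow>
        \<forall>s\<in>S. hnorm H (\<pi> s u \<ominus>\<^bsub>H\<^esub> u) \<le> \<delta> \<Longrightarrow> hnorm H (\<pi> g u \<ominus>\<^bsub>H\<^esub> u) \<le> L g * \<delta>" by metis
    have aiW: "almost_invariant_vectors S1 H' \<rho>"
      unfolding almost_invariant_vectors_def
    proof (intro allI impI)
      fix \<epsilon> :: real assume \<epsilon>: "\<epsilon> > 0"
      \<comment> \<open>With \<open>n\<close> the norm of \<open>u\<close>, the norm of
        \<open>y u\<close> will be at least \<open>(1 - A * \<delta>) * n\<close>, and each
        \<open>f s\<close> will move \<open>y u\<close> by at most \<open>B * \<delta> * n\<close>.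
        The choice of \<delta> solves
        \<open>(B + \<epsilon> * A + 1) * \<delta> = \<epsilon>\<close>, which gives
        \<open>B * \<delta> < \<epsilon> * (1 - A * \<delta>)\<close> with slack \<delta>.\<close>
      define A where "A = (\<Sum>i\<in>I. \<bar>L (inv\<^bsub>G\<^esub> c i)\<bar>)"
      define B where "B = (\<Sum>s\<in>S1. \<Sum>i\<in>I. \<bar>L (f s \<otimes>\<^bsub>G\<^esub> inv\<^bsub>G\<^esub> c i)\<bar> + \<bar>L (inv\<^bsub>G\<^esub> c i)\<bar>)"
      have AB: "A \<ge> 0" "B \<ge> 0" by (auto simp: A_def B_def intro!: sum_nonneg)
      define \<delta> where "\<delta> = \<epsilon> / (B + \<epsilon> * A + 1)"
      have den: "B + \<epsilon> * A + 1 > 0" using AB \<epsilon> by (simp add: add_nonneg_pos)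
      then have \<delta>: "\<delta> > 0" using \<epsilon> by (simp add: \<delta>_def)
      have "(B + \<epsilon> * A + 1) * \<delta> = \<epsilon>" using den by (simp add: \<delta>_def)
      then have \<delta>\<epsilon>: "B * \<delta> < \<epsilon> * (1 - A * \<delta>)" using \<delta> by (simp add: algebra_simps)
      obtain u where u: "u \<in> carrier H" and us: "\<And>s. s \<in> S \<Longrightarrow> hnorm H (\<pi> s u \<ominus>\<^bsub>H\<^esub> u) < \<delta> * hnorm H u"
        using ai \<delta> unfolding almost_invariant_vectors_def by blast
      \<comment> \<open>The strict inequality at a single generator excludes the zero vector; this
        is where \<open>S \<noteq> {}\<close> enters.\<close>
      have n0: "hnorm H u > 0"
      proof -
        obtain s where s: "s \<in> S" using S(4) by blast
        then have "0 \<le> hnorm H (\<pi> s u \<ominus>\<^bsub>H\<^esub> u)" using S(2) u by (intro hnorm_nonneg) auto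
        then have "0 < \<delta> * hnorm H u" using us[OF s] by simp
        then show ?thesis using \<delta> by (simp add: zero_less_mult_iff)
      qed
      define n where "n = hnorm H u"
      have Lu: "hnorm H (\<pi> g u \<ominus>\<^bsub>H\<^esub> u) \<le> \<bar>L g\<bar> * (\<delta> * n)" if g: "g \<in> carrier G" for g
      proof -
        have "hnorm H (\<pi> g u \<ominus>\<^bsub>H\<^esub> u) \<le> L g * (\<delta> * n)"
          using L[OF g u, of "\<delta> * n"] us by (force simp: n_def)
        also have "\<dots> \<le> \<bar>L g\<bar> * (\<delta> * n)" using \<delta> n0 by (intro mult_right_mono) (auto simp: n_def)
        finally show ?thesis .
      qed
      have cu: "(\<lambda>i. \<pi> (inv\<^bsub>G\<^esub> c i) u) \<in> I \<rightarrow> carrier H" using c u by auto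
      have yH: "y u \<in> carrier H" unfolding y_def using cu by (rule M.finsum_closed)
      have lower: "(1 - A * \<delta>) * n \<le> hnorm H (y u)"
      proof -
        define x where "x = finsum H (\<lambda>i. u) I"
        have xH: "x \<in> carrier H" using u by (auto simp: x_def intro!: M.finsum_closed)
        have yx: "y u \<ominus>\<^bsub>H\<^esub> x = finsum H (\<lambda>i. \<pi> (inv\<^bsub>G\<^esub> c i) u \<ominus>\<^bsub>H\<^esub> u) I"
          unfolding y_def x_def using I cu u by (intro finsum_minus) auto
        have "hnorm H (y u \<ominus>\<^bsub>H\<^esub> x) \<le> (\<Sum>i\<in>I. hnorm H (\<pi> (inv\<^bsub>G\<^esub> c i) u \<ominus>\<^bsub>H\<^esub> u))"
          unfolding yx using I c u by (intro hnorm_finsum) auto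
        also have "\<dots> \<le> (\<Sum>i\<in>I. \<bar>L (inv\<^bsub>G\<^esub> c i)\<bar> * (\<delta> * n))"
          using c by (intro sum_mono Lu) auto
        also have "\<dots> = A * \<delta> * n" by (simp add: A_def sum_distrib_right mult.assoc)
        finally have "hnorm H (x \<ominus>\<^bsub>H\<^esub> y u) \<le> A * \<delta> * n" using xH yH by (simp add: hnorm_minus_commute)
        moreover have "hnorm H x \<le> hnorm H (x \<ominus>\<^bsub>H\<^esub> y u) + hnorm H (y u)"
        proof -
          have "x = (x \<ominus>\<^bsub>H\<^esub> y u) \<oplus>\<^bsub>H\<^esub> y u"
            using xH yH by (simp add: a_minus_def M.a_assoc M.l_neg)
          then show ?thesis using hnorm_triangle[of "x \<ominus>\<^bsub>H\<^esub> y u" "y u"] xH yH by simp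
        qed
        moreover have "n \<le> hnorm H x"
        proof -
          have "hnorm H x = real (card I) * n"
            using I u by (simp add: x_def finsum_const hnorm_smult n_def)
          moreover have "1 \<le> real (card I)"
            using I by (simp add: Suc_le_eq card_gt_0_iff)
          ultimately show ?thesis using n0 by (simp add: n_def)
        qed
        ultimately show ?thesis by (simp add: algebra_simps)
      qed
      have "hnorm H (\<pi> (f s) (y u) \<ominus>\<^bsub>H\<^esub> y u) < \<epsilon> * hnorm H (y u)" if s: "s \<in> S1" for s
      proof -
        have sG: "f s \<in> carrier G" using s S1 by auto
        have "\<pi> (f s) (y u) = finsum H (\<lambda>i. \<pi> (f s) (\<pi> (inv\<^bsub>G\<^esub> c i) u)) I"
          unfolding y_def using I sG cu by (intro act_finsum) auto
        also have "\<dots> = finsum H (\<lambda>i. \<pi> (f s \<otimes>\<^bsub>G\<^esub> inv\<^bsub>G\<^esub> c i) u) I"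
          using sG c u by (intro M.finsum_cong') (auto simp: act_mult)
        finally have diff: "\<pi> (f s) (y u) \<ominus>\<^bsub>H\<^esub> y u =
            finsum H (\<lambda>i. \<pi> (f s \<otimes>\<^bsub>G\<^esub> inv\<^bsub>G\<^esub> c i) u \<ominus>\<^bsub>H\<^esub> \<pi> (inv\<^bsub>G\<^esub> c i) u) I"
          unfolding y_def using I sG c u by (simp only:) (intro finsum_minus, auto)
        have "hnorm H (\<pi> (f s) (y u) \<ominus>\<^bsub>H\<^esub> y u) \<le>
            (\<Sum>i\<in>I. hnorm H (\<pi> (f s \<otimes>\<^bsub>G\<^esub> inv\<^bsub>G\<^esub> c i) u \<ominus>\<^bsub>H\<^esub> \<pi> (inv\<^bsub>G\<^esub> c i) u))"
          unfolding diff using I sG c u by (intro hnorm_finsum) auto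
        also have "\<dots> \<le> (\<Sum>i\<in>I. (\<bar>L (f s \<otimes>\<^bsub>G\<^esub> inv\<^bsub>G\<^esub> c i)\<bar> + \<bar>L (inv\<^bsub>G\<^esub> c i)\<bar>) * (\<delta> * n))"
        proof (rule sum_mono)
          fix i assume i: "i \<in> I"
          let ?g = "f s \<otimes>\<^bsub>G\<^esub> inv\<^bsub>G\<^esub> c i" and ?h = "inv\<^bsub>G\<^esub> c i"
          have gh: "?g \<in> carrier G" "?h \<in> carrier G" using sG c[OF i] by auto
          have "hnorm H (\<pi> ?g u \<ominus>\<^bsub>H\<^esub> \<pi> ?h u) \<le> hnorm H (\<pi> ?g u \<ominus>\<^bsub>H\<^esub> u) + hnorm H (u \<ominus>\<^bsub>H\<^esub> \<pi> ?h u)"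
            using gh u by (intro hnorm_diff_triangle) auto
          also have "hnorm H (u \<ominus>\<^bsub>H\<^esub> \<pi> ?h u) = hnorm H (\<pi> ?h u \<ominus>\<^bsub>H\<^esub> u)"
            using gh u by (intro hnorm_minus_commute) auto
          finally show "hnorm H (\<pi> ?g u \<ominus>\<^bsub>H\<^esub> \<pi> ?h u) \<le> (\<bar>L ?g\<bar> + \<bar>L ?h\<bar>) * (\<delta> * n)"
            using Lu[OF gh(1)] Lu[OF gh(2)] by (simp add: algebra_simps)
        qed
        also have "\<dots> = (\<Sum>i\<in>I. \<bar>L (f s \<otimes>\<^bsub>G\<^esub> inv\<^bsub>G\<^esub> c i)\<bar> + \<bar>L (inv\<^bsub>G\<^esub> c i)\<bar>) * (\<delta> * n)"
          by (simp add: sum_distrib_right)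
        also have "\<dots> \<le> B * (\<delta> * n)"
        proof (rule mult_right_mono)
          show "(\<Sum>i\<in>I. \<bar>L (f s \<otimes>\<^bsub>G\<^esub> inv\<^bsub>G\<^esub> c i)\<bar> + \<bar>L (inv\<^bsub>G\<^esub> c i)\<bar>) \<le> B"
            unfolding B_def using s S1(1) by (intro member_le_sum) (auto intro!: sum_nonneg)
        qed (use \<delta> n0 in \<open>simp add: n_def\<close>)
        also have "\<dots> < \<epsilon> * (1 - A * \<delta>) * n"
          using \<delta>\<epsilon> n0 by (simp add: n_def mult.assoc[symmetric])
        also have "\<dots> \<le> \<epsilon> * hnorm H (y u)"
          using lower \<epsilon> by (simp add: mult.assoc)
        finally show ?thesis .
      qed
      moreover have "\<rho> s (y u) \<ominus>\<^bsub>H'\<^esub> y u = \<pi> (f s) (y u) \<ominus>\<^bsub>H\<^esub> y u" if "s \<in> S1" for s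
        using that S1 yW[OF u] actW by (subst transport_minus[symmetric]) (auto simp: \<rho>_def)
      moreover have "\<pi> (f s) (y u) \<ominus>\<^bsub>H\<^esub> y u \<in> W" if "s \<in> S1" for s
        using that S1 yW[OF u] actW by (intro minus_K) auto
      ultimately show "\<exists>v\<in>carrier H'. \<forall>s\<in>S1. hnorm H' (\<rho> s v \<ominus>\<^bsub>H'\<^esub> v) < \<epsilon> * hnorm H' v"
        using yW[OF u] by (intro bexI[of _ "y u"]) (auto simp: transport_simps)
    qed
    have "\<exists>w\<in>carrier H'. w \<noteq> \<zero>\<^bsub>H'\<^esub> \<and> (\<forall>g\<in>carrier G1. \<rho> g w = w)"
      using T1 hilbert_space_transport \<rho>hom aiW unfolding property_T_on_def by blast
    then obtain w where w: "w \<in> W" "w \<noteq> \<zero>\<^bsub>H\<^esub>" "\<forall>g\<in>carrier G1. \<rho> g w = w"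
      by (auto simp: transport_simps)
    \<comment> \<open>The invariant vector supplied by (T) of \<open>G1\<close> is both fixed by
      \<open>K\<close> and orthogonal to all vectors fixed by \<open>K\<close>.\<close>
    then have "w \<in> fixed K" using WH by (auto simp: fixed_def K_def \<rho>_def)
    then have "inner_prod H w w = 0" using w by (auto simp: W_def moved_def)
    then show False using inner_pos[OF WH[OF w(1)] w(2)] by simp
  qed
qed

section \<open>Homomorphisms of presented groups\<close>

definition subst_word :: "('a \<times> bool \<Rightarrow> 'b word) \<Rightarrow> 'a word \<Rightarrow> 'b word" where
  "subst_word e w = concat (map e w)"

text \<open>Taking the union over all words of \<open>A\<close> avoids choosing a representative;
  \<open>subst_class_eq\<close> shows that a class is sent to a single class.\<close>

definition subst_class ::
  "'b set \<Rightarrow> 'b word set \<Rightarrow> ('a \<times> bool \<Rightarrow> 'b word) \<Rightarrow> 'a word set \<Rightarrow> 'b word set" where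
  "subst_class S R e A = word_rel S R `` (subst_word e ` A)"

lemma subst_word_append: "subst_word e (u @ v) = subst_word e u @ subst_word e v"
  by (simp add: subst_word_def)

lemma inv_inv_word: "inv_word (inv_word w) = w"
  by (simp add: inv_word_def rev_map inv_inv_letter o_def)

text \<open>The hypotheses of von Dyck's theorem, with \<open>e\<close> prescribed on inverse
  letters too; \<open>subst_class_hom\<close> is its conclusion.\<close>

locale presentation_map =
  fixes S :: "'a set" and R :: "'a word set" and S' :: "'b set" and R' :: "'b word set"
    and e :: "'a \<times> bool \<Rightarrow> 'b word"
  assumes relators_words: "R \<subseteq> words S"
    and letter_words: "x \<in> S \<times> UNIV \<Longrightarrow> e x \<in> words S'"
    and letter_inv: "x \<in> S \<times> UNIV \<Longrightarrow> e (inv_letter x) = inv_word (e x)"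
    and relators_trivial: "r \<in> R \<Longrightarrow> (subst_word e r, []) \<in> word_rel S' R'"
begin

lemma subst_word_words: "w \<in> words S \<Longrightarrow> subst_word e w \<in> words S'"
  by (induction w) (auto simp: subst_word_def Nil_in_words words_Cons words_append letter_words)

lemma subst_deletion:
  assumes "(u, v) \<in> deletion S R"
  shows "(subst_word e u, subst_word e v) \<in> word_rel S' R'"
proof -
  from assms obtain a c b where *: "u = a @ c @ b" "v = a @ b" "a \<in> words S" "b \<in> words S"
    "c \<in> R \<or> (\<exists>x \<in> S \<times> UNIV. c = [x, inv_letter x])"
    unfolding deletion_def by blast
  have "(subst_word e c, []) \<in> word_rel S' R'"
  proof (cases "c \<in> R")
    case False
    then obtain x where x: "x \<in> S \<times> UNIV" "c = [x, inv_letter x]" using *(5) by blast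
    \<comment> \<open>\<open>inv_word_cancel\<close> has the inverse on the left, so it is applied
      to \<open>inv_word (e x)\<close>.\<close>
    have "(inv_word (inv_word (e x)) @ inv_word (e x), []) \<in> word_rel S' R'"
      by (intro inv_word_cancel inv_word_in_words letter_words x)
    then show ?thesis using x by (simp add: subst_word_def inv_inv_word letter_inv)
  qed (rule relators_trivial)
  then have "(subst_word e a @ subst_word e c @ subst_word e b, subst_word e a @ [] @ subst_word e b)
      \<in> word_rel S' R'"
    using * by (intro word_rel_append word_rel_refl subst_word_words) auto
  then show ?thesis using * by (simp add: subst_word_append)
qed

lemma subst_word_rel:
  assumes "(u, v) \<in> word_rel S R"
  shows "(subst_word e u, subst_word e v) \<in> word_rel S' R'"
proof -
  have u: "u \<in> words S" and "(u, v) \<in> (deletion S R \<union> (deletion S R)\<inverse>)\<^sup>*"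
    using assms by (auto simp: word_rel_def)
  from this(2) show ?thesis
  proof induction
    case base
    show ?case using u by (intro word_rel_refl subst_word_words)
  next
    case (step y z)
    have "sym (word_rel S' R')" using equiv_word_rel by (rule equivE)
    then have "(subst_word e y, subst_word e z) \<in> word_rel S' R'"
      using step.hyps(2) subst_deletion by (auto dest: symD)
    with step.IH show ?case by (rule word_rel_trans)
  qed
qed

lemma subst_class_eq:
  assumes "w \<in> words S"
  shows "subst_class S' R' e (word_rel S R `` {w}) = word_rel S' R' `` {subst_word e w}"
proof -
  have "word_rel S' R' `` {subst_word e v} = word_rel S' R' `` {subst_word e w}"
    if "v \<in> word_rel S R `` {w}" for v
    using that equiv_class_eq[OF equiv_word_rel subst_word_rel, of w v] by simp
  moreover have "w \<in> word_rel S R `` {w}" using assms by (rule equiv_class_self[OF equiv_word_rel])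
  ultimately show ?thesis unfolding subst_class_def by blast
qed

lemma subst_class_hom: "subst_class S' R' e \<in> hom (presented_group S R) (presented_group S' R')"
proof (rule homI)
  fix A assume "A \<in> carrier (presented_group S R)"
  then show "subst_class S' R' e A \<in> carrier (presented_group S' R')"
    by (elim presented_carrierE) (simp add: subst_class_eq presented_carrierI subst_word_words)
next
  fix A B assume "A \<in> carrier (presented_group S R)" "B \<in> carrier (presented_group S R)"
  then show "subst_class S' R' e (A \<otimes>\<^bsub>presented_group S R\<^esub> B) =
      subst_class S' R' e A \<otimes>\<^bsub>presented_group S' R'\<^esub> subst_class S' R' e B"
    by (elim presented_carrierE)
      (simp add: presented_mult subst_class_eq subst_word_words subst_word_append words_append)
qed

lemma subst_class_image:
  assumes "w \<in> words S"
  shows "word_rel S' R' `` {subst_word e w} \<in> subst_class S' R' e ` carrier (presented_group S R)"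
  using assms by (metis subst_class_eq presented_carrierI imageI)

end

section \<open>Quotients, and subgroups generated by blocks of letters\<close>

lemma presented_gens_subset: "presented_gens S R \<subseteq> carrier (presented_group S R)"
  by (auto simp: presented_gens_def words_Cons Nil_in_words intro!: presented_carrierI)

lemma relator_trivial:
  assumes "r \<in> R" "r \<in> words S" shows "(r, []) \<in> word_rel S R"
proof -
  have "([] @ r @ [], [] @ []) \<in> deletion S R"
    unfolding deletion_def using assms Nil_in_words by blast
  then show ?thesis using assms by (auto simp: word_rel_def Nil_in_words)
qed

text \<open>The identity on letters induces a surjection, so the finite-index theorem applies with a
  single coset, represented by the unit.\<close>

lemma property_T_more_relators:
  assumes T: "property_T (presented_group S R) (presented_gens S R)"
    and S: "finite S" "S \<noteq> {}" and R: "R \<subseteq> R'" "R' \<subseteq> words S"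
  shows "property_T (presented_group S R') (presented_gens S R')"
proof -
  have id: "subst_word (\<lambda>x. [x]) w = w" for w :: "'a word"
    by (induction w) (auto simp: subst_word_def)
  interpret presentation_map S R S R' "\<lambda>x. [x]"
    using R by unfold_locales
      (auto simp: words_Cons Nil_in_words inv_word_def id intro: relator_trivial)
  interpret group "presented_group S R'" by (rule group_presented_group)
  have gens: "s \<in> carrier (presented_group S R')" if "s \<in> presented_gens S R'" for s
    using that presented_gens_subset by blast
  show ?thesis
  proof (rule property_T_finite_index_image[OF T group_presented_group _ _ _ _ subst_class_hom,
        where I = "{()}" and c = "\<lambda>_. \<one>\<^bsub>presented_group S R'\<^esub>" and \<sigma> = "\<lambda>_ i. i"])
    fix s assume s: "s \<in> presented_gens S R'"
    then obtain w where "w \<in> words S" "s = word_rel S R' `` {w}"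
      using gens presented_carrierE by metis
    then show "inv\<^bsub>presented_group S R'\<^esub> \<one>\<^bsub>presented_group S R'\<^esub> \<otimes>\<^bsub>presented_group S R'\<^esub>
        (s \<otimes>\<^bsub>presented_group S R'\<^esub> \<one>\<^bsub>presented_group S R'\<^esub>)
        \<in> subst_class S R' (\<lambda>x. [x]) ` carrier (presented_group S R)"
      using gens[OF s] subst_class_image[of w] by (simp add: id)
  qed (use S in \<open>simp_all add: presented_gens_subset generate_presented_gens\<close>,
      simp_all add: presented_gens_def)
qed

text \<open>
  Words of length \<open>j\<close> generate a subgroup whose cosets are represented by the powers
  \<open>s\<^sup>i\<close>, \<open>i < j\<close>, of any fixed generator \<open>s\<close>.
\<close>

lemma property_T_blocks:
  fixes S :: "'b set" and T :: "'a set" and \<beta> :: "'a \<Rightarrow> 'b word"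
  assumes prop_T: "property_T (presented_group T R) (presented_gens T R)"
    and S: "finite S" "S \<noteq> {}" and j: "j \<ge> 1"
    and \<beta>: "\<beta> ` T = {w \<in> lists (S \<times> {True}). length w = j}"
    and R: "R \<subseteq> lists (T \<times> {True})"
  defines "e \<equiv> \<lambda>x. if snd x then \<beta> (fst x) else inv_word (\<beta> (fst x))"
  shows "property_T (presented_group S (subst_word e ` R)) (presented_gens S (subst_word e ` R))"
proof -
  let ?R = "subst_word e ` R"
  have \<beta>w: "\<beta> t \<in> words S" if "t \<in> T" for t
  proof -
    have "\<beta> t \<in> lists (S \<times> {True})" using that \<beta> by blast
    then show ?thesis by (auto simp: words_def in_lists_conv_set)
  qed
  have e_words: "e x \<in> words S" if "x \<in> T \<times> UNIV" for x
    using that \<beta>w by (auto simp: e_def inv_word_in_words)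
  have subst_words: "subst_word e w \<in> words S" if "w \<in> words T" for w
    using that e_words
    by (induction w) (auto simp: subst_word_def Nil_in_words words_Cons words_append)
  have RT: "R \<subseteq> words T" using R by (auto simp: words_def in_lists_conv_set subset_iff)
  interpret presentation_map T R S ?R e
  proof
    show "e (inv_letter x) = inv_word (e x)" for x
      by (auto simp: e_def inv_letter_def inv_inv_word)
    show "(subst_word e r, []) \<in> word_rel S ?R" if "r \<in> R" for r
      using that RT subst_words by (intro relator_trivial) auto
  qed (use RT e_words in auto)
  define G where "G = presented_group S ?R"
  define K where "K = subst_class S ?R e ` carrier (presented_group T R)"
  interpret G: group G unfolding G_def by (rule group_presented_group)
  interpret f: group_hom "presented_group T R" G "subst_class S ?R e"
    unfolding G_def
    by (intro group_hom.intro group_presented_group group_hom_axioms.intro subst_class_hom)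
  have K: "subgroup K G" unfolding K_def by (rule f.img_is_subgroup)
  define cl where "cl w = word_rel S ?R `` {w}" for w
  have mult: "cl u \<otimes>\<^bsub>G\<^esub> cl v = cl (u @ v)" if "u \<in> words S" "v \<in> words S" for u v
    using that by (simp add: cl_def G_def presented_mult)
  have clG: "cl w \<in> carrier G" if "w \<in> words S" for w
    using that by (simp add: cl_def G_def presented_carrierI)
  \<comment> \<open>Surjectivity of \<beta> onto the positive words of length \<open>j\<close> is
    used here: each of them is the image of one generator.\<close>
  have block: "cl w \<in> K" if w: "w \<in> lists (S \<times> {True})" "length w = j" for w
  proof -
    obtain t where t: "t \<in> T" "w = \<beta> t" using w \<beta> by blast
    then have "subst_word e [(t, True)] = w" "[(t, True)] \<in> words T"
      by (auto simp: subst_word_def e_def words_Cons Nil_in_words)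
    then show ?thesis using subst_class_image[of "[(t, True)]"] by (simp add: K_def cl_def)
  qed
  obtain s0 where s0: "s0 \<in> S" using S by blast
  define p where "p i = replicate i (s0, True)" for i :: nat
  have pl: "p i \<in> lists (S \<times> {True})" "length (p i) = i" for i
    using s0 by (auto simp: p_def in_lists_conv_set)
  have pw: "p i \<in> words S" for i using s0 by (auto simp: p_def words_def in_lists_conv_set)
  show ?thesis
  \<comment> \<open>The coset of a positive word depends only on its length modulo \<open>j\<close>,
    so every generator acts on the indices by the same cyclic shift.\<close>
  proof (rule property_T_finite_index_image[OF prop_T group_presented_group _ _ _ _ subst_class_hom,
        where I = "{..<j}" and c = "\<lambda>i. cl (p i)" and \<sigma> = "\<lambda>_ i. if Suc i = j then 0 else Suc i"])
    fix g i assume "g \<in> presented_gens S ?R" and i: "i \<in> {..<j}"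
    then obtain t where t: "t \<in> S" and g: "g = cl [(t, True)]"
      by (auto simp: presented_gens_def cl_def)
    have tw: "[(t, True)] \<in> words S" using t by (simp add: words_Cons Nil_in_words)
    have tp: "g \<otimes>\<^bsub>G\<^esub> cl (p i) = cl ((t, True) # p i)" using g mult[OF tw pw] by simp
    have tpw: "(t, True) # p i \<in> words S" using tw pw by (simp add: words_Cons)
    have "inv\<^bsub>G\<^esub> cl (p (if Suc i = j then 0 else Suc i)) \<otimes>\<^bsub>G\<^esub> (g \<otimes>\<^bsub>G\<^esub> cl (p i)) \<in> K"
    proof (cases "Suc i = j")
      case True
      have "cl (p 0) = \<one>\<^bsub>G\<^esub>" by (simp add: p_def cl_def G_def presented_one)
      moreover have "cl ((t, True) # p i) \<in> K" using True t pl by (intro block) auto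
      ultimately show ?thesis using True clG[OF tpw] by (simp add: tp)
    next
      case False
      \<comment> \<open>The inverse of \<open>cl (p (Suc i))\<close> is rewritten as the inverse of
        \<open>cl (p j)\<close> times \<open>q\<close>. The letter then sits between powers of
        \<open>s0\<close> with total length \<open>j\<close>, and both factors are classes of blocks
        or inverses of such.\<close>
      define q where "q = cl (p (j - Suc i))"
      have qG: "q \<in> carrier G" unfolding q_def by (rule clG[OF pw])
      have "q \<otimes>\<^bsub>G\<^esub> cl (p (Suc i)) = cl (p j)"
      proof -
        have "p (j - Suc i) @ p (Suc i) = p j"
          using i unfolding p_def replicate_add[symmetric] by simp
        then show ?thesis unfolding q_def mult[OF pw pw] by simp
      qed
      then have "inv\<^bsub>G\<^esub> cl (p (Suc i)) = inv\<^bsub>G\<^esub> cl (p j) \<otimes>\<^bsub>G\<^esub> q"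
        using G.inv_mult_group[OF qG clG[OF pw[of "Suc i"]]] qG clG[OF pw[of "Suc i"]]
        by (simp add: G.m_assoc)
      then have "inv\<^bsub>G\<^esub> cl (p (Suc i)) \<otimes>\<^bsub>G\<^esub> (g \<otimes>\<^bsub>G\<^esub> cl (p i)) =
          inv\<^bsub>G\<^esub> cl (p j) \<otimes>\<^bsub>G\<^esub> (q \<otimes>\<^bsub>G\<^esub> cl ((t, True) # p i))"
        using qG clG[OF tpw] clG[OF pw] by (simp add: tp G.m_assoc)
      also have "q \<otimes>\<^bsub>G\<^esub> cl ((t, True) # p i) = cl (p (j - Suc i) @ (t, True) # p i)"
        unfolding q_def by (rule mult[OF pw tpw])
      also have "inv\<^bsub>G\<^esub> cl (p j) \<otimes>\<^bsub>G\<^esub> \<dots> \<in> K"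
      proof (intro subgroup.m_closed[OF K] subgroup.m_inv_closed[OF K] block)
        show "p (j - Suc i) @ (t, True) # p i \<in> lists (S \<times> {True})" using pl t by simp
        show "length (p (j - Suc i) @ (t, True) # p i) = j" using pl i by simp
      qed (rule pl)+
      finally show ?thesis using False by simp
    qed
    then show "inv\<^bsub>presented_group S ?R\<^esub> cl (p (if Suc i = j then 0 else Suc i))
        \<otimes>\<^bsub>presented_group S ?R\<^esub> (g \<otimes>\<^bsub>presented_group S ?R\<^esub> cl (p i))
        \<in> subst_class S ?R e ` carrier (presented_group T R)"
      by (simp only: G_def K_def)
  next
    fix i show "cl (p i) \<in> carrier (presented_group S ?R)" using clG[OF pw] by (simp only: G_def)
  next
    show "bij_betw (\<lambda>i. if Suc i = j then 0 else Suc i) {..<j} {..<j}"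
      by (rule bij_betw_byWitness[where f' = "\<lambda>i. if i = 0 then j - 1 else i - 1"]) (use j in auto)
  next
    show "generate (presented_group S ?R) (presented_gens S ?R) = carrier (presented_group S ?R)"
      by (rule generate_presented_gens)
  next
    show "presented_gens S ?R \<subseteq> carrier (presented_group S ?R)" by (rule presented_gens_subset)
  qed (use S j in \<open>auto simp: presented_gens_def lessThan_empty_iff\<close>)
qed

section \<open>Failure probabilities\<close>

lemma finite_positive_words: "finite (positive_words n k)"
  and card_positive_words: "card (positive_words n k) = n ^ k"
proof -
  have eq: "positive_words n k = {w. set w \<subseteq> {..<n} \<times> {True} \<and> length w = k}"
    by (auto simp: positive_words_def in_lists_conv_set)
  show "finite (positive_words n k)" unfolding eq by (intro finite_lists_length_eq) simp
  show "card (positive_words n k) = n ^ k"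
    unfolding eq by (subst card_lists_length_eq) (simp_all add: card_cartesian_product)
qed

lemma finite_cyc_reduced_words: "finite (cyc_reduced_words n k)"
  and card_cyc_reduced_words_le: "card (cyc_reduced_words n k) \<le> (2 * n) ^ k"
proof -
  have sub: "cyc_reduced_words n k \<subseteq> {w. set w \<subseteq> {..<n} \<times> UNIV \<and> length w = k}"
    by (auto simp: cyc_reduced_words_def words_def in_lists_conv_set)
  have fin: "finite {w :: nat word. set w \<subseteq> {..<n} \<times> UNIV \<and> length w = k}"
    by (intro finite_lists_length_eq) simp
  show "finite (cyc_reduced_words n k)" using sub fin by (rule finite_subset)
  have "card {w :: nat word. set w \<subseteq> {..<n} \<times> UNIV \<and> length w = k} = (2 * n) ^ k"
    by (subst card_lists_length_eq) (simp_all add: card_cartesian_product mult.commute)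
  then show "card (cyc_reduced_words n k) \<le> (2 * n) ^ k" using card_mono[OF fin sub] by simp
qed

lemma positive_words_subset_words: "positive_words n k \<subseteq> words {..<n}"
  by (auto simp: positive_words_def words_def in_lists_conv_set)

text \<open>Two positive letters are never inverse to each other, also across the ends of the
  word.\<close>

lemma positive_words_cyc_reduced: "positive_words n k \<subseteq> cyc_reduced_words n k"
proof
  fix w assume w: "w \<in> positive_words n k"
  then have pos: "snd (w ! i)" if "i < length w" for i
    using nth_mem[OF that] by (fastforce simp: positive_words_def in_lists_conv_set)
  have "w ! (Suc i mod length w) \<noteq> inv_letter (w ! i)" if i: "i < length w" for i
  proof -
    have "Suc i mod length w < length w" using i by (intro mod_less_divisor) auto
    then have "snd (w ! (Suc i mod length w))" by (rule pos)
    then show ?thesis using pos[OF i] by (auto simp: inv_letter_def)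
  qed
  then show "w \<in> cyc_reduced_words n k"
    using w positive_words_subset_words
    by (auto simp: cyc_reduced_words_def cyclically_reduced_def positive_words_def)
qed

text \<open>For finite \<open>U\<close> this is the probability of failing (T) when
  \<open>m \<le> card U\<close>; for larger \<open>m\<close> the denominator is zero and the value
  is 0.\<close>

definition failure_ratio :: "nat \<Rightarrow> nat word set \<Rightarrow> nat \<Rightarrow> real" where
  "failure_ratio n U m = real (card {R. R \<subseteq> U \<and> card R = m \<and>
     \<not> property_T (presented_group {..<n} R) (presented_gens {..<n} R)}) / real (card U choose m)"

lemma failure_ratio_nonneg: "0 \<le> failure_ratio n U m"
  by (simp add: failure_ratio_def)

lemma prob_property_T:
  assumes U: "finite U" and m: "m \<le> card U"
  shows "measure_pmf.prob (pmf_of_set {R. R \<subseteq> U \<and> card R = m})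
    {R. property_T (presented_group {..<n} R) (presented_gens {..<n} R)} = 1 - failure_ratio n U m"
proof -
  let ?A = "{R. R \<subseteq> U \<and> card R = m}"
  let ?T = "{R. property_T (presented_group {..<n} R) (presented_gens {..<n} R)}"
  have fin: "finite ?A" using U by (auto intro: finite_subset[of _ "Pow U"])
  have card: "card ?A = card U choose m" using U by (rule n_subsets)
  then have pos: "card ?A > 0" using m by simp
  then have ne: "?A \<noteq> {}" unfolding card_gt_0_iff by (rule conjunct1)
  have "card (?A \<inter> ?T) + card (?A - ?T) = card ?A"
    by (rule card_Int_Diff[OF fin, symmetric])
  moreover have "?A - ?T = {R. R \<subseteq> U \<and> card R = m \<and>
     \<not> property_T (presented_group {..<n} R) (presented_gens {..<n} R)}" by auto
  ultimately have "real (card (?A \<inter> ?T)) = real (card ?A) - real (card {R. R \<subseteq> U \<and> card R = m \<and>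
     \<not> property_T (presented_group {..<n} R) (presented_gens {..<n} R)})" by simp
  then show ?thesis
    unfolding measure_pmf_of_set[OF ne fin] failure_ratio_def card[symmetric]
    using pos by (simp add: diff_divide_distrib)
qed

text \<open>The bound on \<open>m n\<close> is asked only eventually: where it fails the
  distribution is unspecified, but finitely many \<open>n\<close> do not affect the limit.\<close>

lemma overwhelming_T_iff:
  assumes fin: "\<And>n. finite (U n)" and m: "\<forall>\<^sub>F n in sequentially. m n \<le> card (U n)"
  shows "overwhelming_T (\<lambda>n. pmf_of_set {R. R \<subseteq> U n \<and> card R = m n}) \<longleftrightarrow>
    (\<lambda>n. failure_ratio n (U n) (m n)) \<longlonglongrightarrow> 0"
proof -
  have "overwhelming_T (\<lambda>n. pmf_of_set {R. R \<subseteq> U n \<and> card R = m n}) \<longleftrightarrow>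
      (\<lambda>n. 1 - failure_ratio n (U n) (m n)) \<longlonglongrightarrow> 1"
    unfolding overwhelming_T_def
    by (intro tendsto_cong eventually_mono[OF m] prob_property_T fin)
  also have "\<dots> \<longleftrightarrow> (\<lambda>n. failure_ratio n (U n) (m n)) \<longlonglongrightarrow> 0"
  proof
    assume "(\<lambda>n. 1 - failure_ratio n (U n) (m n)) \<longlonglongrightarrow> 1"
    from tendsto_diff[OF tendsto_const[of 1] this]
    show "(\<lambda>n. failure_ratio n (U n) (m n)) \<longlonglongrightarrow> 0" by simp
  next
    assume "(\<lambda>n. failure_ratio n (U n) (m n)) \<longlonglongrightarrow> 0"
    from tendsto_diff[OF tendsto_const[of 1] this]
    show "(\<lambda>n. 1 - failure_ratio n (U n) (m n)) \<longlonglongrightarrow> 1" by simp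
  qed
  finally show ?thesis .
qed

text \<open>By \<open>property_T_more_relators\<close>, failing (T) passes to subsets of the
  relators, so it is a down-set to which \<open>card_downset_levels\<close> applies.\<close>

lemma failure_ratio_mono:
  assumes n: "n \<ge> 1" and U: "finite U" "U \<subseteq> words {..<n}" and ab: "a \<le> b" "a \<le> card U"
  shows "failure_ratio n U b \<le> failure_ratio n U a"
proof -
  define B where
    "B R \<longleftrightarrow> \<not> property_T (presented_group {..<n} R) (presented_gens {..<n} R)" for R
  have "card {Z. Z \<subseteq> U \<and> card Z = b \<and> B Z} * (card U choose a) \<le>
      card {Q. Q \<subseteq> U \<and> card Q = a \<and> B Q} * (card U choose b)"
  proof (rule card_downset_levels[OF U(1) ab(1)])
    fix Q Z assume "Q \<subseteq> Z" "Z \<subseteq> U" "B Z"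
    then show "B Q"
      unfolding B_def using property_T_more_relators[of "{..<n}" Q Z] n U
      by (metis finite_lessThan lessThan_empty_iff not_one_le_zero order_trans)
  qed
  then have *: "real (card {Z. Z \<subseteq> U \<and> card Z = b \<and> B Z}) * real (card U choose a) \<le>
      real (card {Q. Q \<subseteq> U \<and> card Q = a \<and> B Q}) * real (card U choose b)"
    by (simp only: of_nat_mult[symmetric] of_nat_le_iff)
  have pos: "real (card U choose a) > 0" using ab by simp
  show ?thesis
  proof (cases "b \<le> card U")
    case True
    then have "real (card U choose b) > 0" by simp
    then show ?thesis using * pos unfolding failure_ratio_def B_def by (simp add: field_simps)
  next
    \<comment> \<open>There are not enough words for \<open>b\<close> relators; the ratio is 0
      through division by zero.\<close>
    case False
    then have "failure_ratio n U b = 0" by (simp add: failure_ratio_def)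
    then show ?thesis by (simp add: failure_ratio_nonneg)
  qed
qed

text \<open>All blocks have length \<open>j\<close>, so a concatenation can be decoded block by
  block. Surjectivity follows by counting, from (n^j)^k = n^(j*k).\<close>

lemma bij_betw_blocks:
  fixes \<beta> :: "nat \<Rightarrow> nat word"
  assumes \<beta>: "bij_betw \<beta> {..<n ^ j} (positive_words n j)"
    and e: "\<And>t. e (t, True) = \<beta> t"
  shows "bij_betw (subst_word e) (positive_words (n ^ j) k) (positive_words n (j * k))"
proof -
  let ?P = "positive_words (n ^ j) k"
  have \<beta>w: "\<beta> t \<in> lists ({..<n} \<times> {True})" "length (\<beta> t) = j" if "t < n ^ j" for t
  proof -
    have "\<beta> t \<in> positive_words n j" using that \<beta> by (auto simp: bij_betw_def)
    then show "\<beta> t \<in> lists ({..<n} \<times> {True})" "length (\<beta> t) = j" by (auto simp: positive_words_def)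
  qed
  have into: "subst_word e w \<in> lists ({..<n} \<times> {True}) \<and> length (subst_word e w) = j * length w"
    if "w \<in> lists ({..<n ^ j} \<times> {True})" for w
    using that
  proof (induction w)
    case (Cons x w)
    then obtain t where "x = (t, True)" "t < n ^ j" by auto
    then show ?case using Cons \<beta>w[of t] by (auto simp: subst_word_def e)
  qed (simp add: subst_word_def)
  have inj: "u = v" if "length u = length v" "u \<in> lists ({..<n ^ j} \<times> {True})"
    "v \<in> lists ({..<n ^ j} \<times> {True})" "subst_word e u = subst_word e v" for u v
    using that
  proof (induction u v rule: list_induct2)
    case (Cons x u y v)
    then obtain s t where st: "x = (s, True)" "s < n ^ j" "y = (t, True)" "t < n ^ j" by auto
    then have "\<beta> s = \<beta> t \<and> subst_word e u = subst_word e v"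
      using Cons.prems(3) \<beta>w(2)[of s] \<beta>w(2)[of t] by (simp add: subst_word_def e)
    moreover from this have "s = t" using st \<beta> by (auto simp: bij_betw_def inj_on_def)
    ultimately show ?case using Cons st by auto
  qed simp
  have "inj_on (subst_word e) ?P"
    using inj by (auto simp: inj_on_def positive_words_def)
  moreover have "subst_word e ` ?P \<subseteq> positive_words n (j * k)"
    using into by (auto simp: positive_words_def)
  moreover have "card ?P = card (positive_words n (j * k))"
    by (simp add: card_positive_words power_mult)
  ultimately show ?thesis
    by (metis bij_betw_def card_image card_subset_eq finite_positive_words)
qed

text \<open>By the contrapositive of \<open>property_T_blocks\<close>, a failing relator set over
  \<open>n\<close> letters is the image of a failing set of the same size over n^j letters. The
  denominators agree because both word sets have the same cardinality.\<close>

lemma failure_ratio_blocks: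
  assumes n: "n \<ge> 1" and j: "j \<ge> 1"
  shows "failure_ratio n (positive_words n (j * k)) m \<le>
    failure_ratio (n ^ j) (positive_words (n ^ j) k) m"
proof -
  obtain \<beta> where \<beta>: "bij_betw \<beta> {..<n ^ j} (positive_words n j)"
    using finite_same_card_bij[of "{..<n ^ j}" "positive_words n j"]
    by (auto simp: finite_positive_words card_positive_words)
  define e where "e = (\<lambda>x. if snd x then \<beta> (fst x) else inv_word (\<beta> (fst x)))"
  have bij: "bij_betw (subst_word e) (positive_words (n ^ j) k) (positive_words n (j * k))"
    by (rule bij_betw_blocks[OF \<beta>]) (simp add: e_def)
  let ?P = "positive_words (n ^ j) k" and ?Q = "positive_words n (j * k)"
  let ?bad = "\<lambda>n U. {R. R \<subseteq> U \<and> card R = m \<and>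
     \<not> property_T (presented_group {..<n} R) (presented_gens {..<n} R)}"
  have "?bad n ?Q \<subseteq> (`) (subst_word e) ` ?bad (n ^ j) ?P"
  proof
    fix Q assume Q: "Q \<in> ?bad n ?Q"
    define R where "R = {w \<in> ?P. subst_word e w \<in> Q}"
    have RP: "R \<subseteq> ?P" by (auto simp: R_def)
    have QR: "Q = subst_word e ` R"
      using Q bij by (auto simp: R_def bij_betw_def)
    have "inj_on (subst_word e) R" using bij RP by (auto simp: bij_betw_def intro: inj_on_subset)
    then have "card R = m" using Q QR by (simp add: card_image)
    moreover have "\<not> property_T (presented_group {..<n ^ j} R) (presented_gens {..<n ^ j} R)"
    proof
      assume T: "property_T (presented_group {..<n ^ j} R) (presented_gens {..<n ^ j} R)"
      have "property_T (presented_group {..<n} (subst_word e ` R)) (presented_gens {..<n} (subst_word e ` R))"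
        unfolding e_def
      proof (rule property_T_blocks[OF T _ _ j])
        show "\<beta> ` {..<n ^ j} = {w \<in> lists ({..<n} \<times> {True}). length w = j}"
          using \<beta> by (simp add: bij_betw_def positive_words_def)
        show "R \<subseteq> lists ({..<n ^ j} \<times> {True})" using RP by (auto simp: positive_words_def)
      qed (use n in \<open>auto simp: lessThan_empty_iff\<close>)
      then show False using Q QR by simp
    qed
    ultimately show "Q \<in> (`) (subst_word e) ` ?bad (n ^ j) ?P"
      using RP QR by blast
  qed
  moreover have "finite (?bad (n ^ j) ?P)"
    by (rule finite_subset[of _ "Pow ?P"]) (auto simp: finite_positive_words)
  ultimately have "card (?bad n ?Q) \<le> card (?bad (n ^ j) ?P)"
    by (rule surj_card_le[rotated])
  then have "real (card (?bad n ?Q)) \<le> real (card (?bad (n ^ j) ?P))" by simp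
  then show ?thesis
    unfolding failure_ratio_def card_positive_words power_mult by (rule divide_right_mono) simp
qed

text \<open>A failing \<open>R\<close> has a failing trace on \<open>P\<close>. Either the trace has
  fewer than \<open>a\<close> elements, which \<open>card_small_trace\<close> makes rare, or
  \<open>card_downset_trace\<close> compares it with a uniform \<open>a\<close>-subset of
  \<open>P\<close>.\<close>

lemma failure_ratio_trace:
  assumes n: "n \<ge> 1" and C: "finite C" "C \<subseteq> words {..<n}" and P: "P \<subseteq> C" "P \<noteq> {}"
    and m: "m \<le> card C" "0 < m" and a: "a \<le> card P"
    and \<mu>: "\<mu> = real (card P) * real m / real (card C)" "2 * real a \<le> \<mu>"
  shows "failure_ratio n C m \<le> 4 / \<mu> + failure_ratio n P a"
proof -
  define B where
    "B R \<longleftrightarrow> \<not> property_T (presented_group {..<n} R) (presented_gens {..<n} R)" for R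
  have down: "B Q" if "Q \<subseteq> Z" "Z \<subseteq> C" "B Z" for Q Z
    using that property_T_more_relators[of "{..<n}" Q Z] n C
    unfolding B_def by (metis finite_lessThan lessThan_empty_iff not_one_le_zero order_trans)
  let ?bad = "{R. R \<subseteq> C \<and> card R = m \<and> B R}"
  let ?small = "{R. R \<subseteq> C \<and> card R = m \<and> card (R \<inter> P) < a}"
  let ?large = "{R. R \<subseteq> C \<and> card R = m \<and> a \<le> card (R \<inter> P) \<and> B (R \<inter> P)}"
  have fin: "finite ?small" "finite ?large" using C by (auto intro: finite_subset[of _ "Pow C"])
  have "B (R \<inter> P)" if "R \<subseteq> C" "B R" for R using down[of "R \<inter> P" R] that by simp
  then have "?bad \<subseteq> ?small \<union> ?large" by (auto simp: not_less)
  then have "card ?bad \<le> card ?small + card ?large"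
    using fin by (meson card_Un_le card_mono finite_UnI le_trans)
  then have bad: "real (card ?bad) \<le> real (card ?small) + real (card ?large)" by linarith
  have small: "real (card ?small) \<le> 4 / \<mu> * real (card C choose m)"
    by (rule card_small_trace[OF C(1) P m \<mu>])
  have "card ?large * (card P choose a) \<le>
      card {Q. Q \<subseteq> P \<and> card Q = a \<and> B Q} * (card C choose m)"
    using down P by (intro card_downset_trace[OF C(1) P(1)]) blast
  then have "real (card ?large) * real (card P choose a) \<le>
      real (card {Q. Q \<subseteq> P \<and> card Q = a \<and> B Q}) * real (card C choose m)"
    by (simp only: of_nat_mult[symmetric] of_nat_le_iff)
  moreover have "real (card P choose a) > 0" using a by simp
  ultimately have "real (card ?large) \<le> failure_ratio n P a * real (card C choose m)"
    unfolding failure_ratio_def B_def by (simp add: field_simps)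
  with bad small have "real (card ?bad) \<le> (4 / \<mu> + failure_ratio n P a) * real (card C choose m)"
    by (simp add: algebra_simps)
  moreover have "real (card C choose m) > 0" using m by simp
  ultimately show ?thesis unfolding failure_ratio_def[of n C] B_def by (simp add: divide_le_eq)
qed

section \<open>Asymptotics of the number of relators, and the two transfers\<close>

lemma eventually_num_relators_le:
  assumes "d < 1"
  shows "\<forall>\<^sub>F n in sequentially. num_relators k n d \<le> n ^ k"
proof -
  have "\<forall>\<^sub>F n in sequentially. (2 * real n - 1) powr d \<le> real n"
    using assms by real_asymp
  moreover have "\<forall>\<^sub>F n :: nat in sequentially. n \<ge> 1" by (rule eventually_ge_at_top)
  ultimately show ?thesis
  proof eventually_elim
    case (elim n)
    have "(2 * real n - 1) powr (real k * d) = ((2 * real n - 1) powr d) powr real k"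
      by (simp add: powr_powr mult.commute)
    also have "\<dots> \<le> real n powr real k" using elim by (intro powr_mono2) auto
    also have "\<dots> = real (n ^ k)" using elim by (simp add: powr_realpow)
    finally have "\<lfloor>(2 * real n - 1) powr (real k * d)\<rfloor> \<le> int (n ^ k)" by linarith
    then show ?case unfolding num_relators_def by linarith
  qed
qed

lemma two_power_minus_one_le: "x \<ge> 1 \<Longrightarrow> 2 * x ^ j - 1 \<le> (2 * x - 1) ^ j" for x :: real
proof (induction j)
  case (Suc j)
  \<comment> \<open>Twice this product is exactly the difference between
    \<open>(2 * x ^ j - 1) * (2 * x - 1)\<close> and \<open>2 * x ^ Suc j - 1\<close>.\<close>
  have "0 \<le> (x ^ j - 1) * (x - 1)" using Suc.prems by (intro mult_nonneg_nonneg) auto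
  then have "2 * x ^ Suc j - 1 \<le> (2 * x ^ j - 1) * (2 * x - 1)" by (simp add: algebra_simps)
  also have "\<dots> \<le> (2 * x - 1) ^ j * (2 * x - 1)"
    using Suc by (intro mult_right_mono) auto
  finally show ?case by (simp add: mult.commute)
qed simp

lemma num_relators_blocks:
  assumes "n \<ge> 1" "0 < d"
  shows "num_relators k (n ^ j) d \<le> num_relators (j * k) n d"
proof -
  have "1 \<le> real n ^ j" using assms by simp
  then have "0 \<le> 2 * real n ^ j - 1" by linarith
  then have "(2 * real (n ^ j) - 1) powr (real k * d) \<le> ((2 * real n - 1) ^ j) powr (real k * d)"
    using two_power_minus_one_le[of "real n" j] assms by (intro powr_mono2) auto
  also have "\<dots> = (2 * real n - 1) powr (real (j * k) * d)"
    using assms by (simp add: powr_realpow[symmetric] powr_powr mult.assoc)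
  finally show ?thesis unfolding num_relators_def by (intro nat_mono floor_mono)
qed

lemma overwhelming_T_positive_iff:
  assumes "d < 1"
  shows "overwhelming_T (positive_gonal_model k d) \<longleftrightarrow>
    (\<lambda>n. failure_ratio n (positive_words n k) (num_relators k n d)) \<longlonglongrightarrow> 0"
  using overwhelming_T_iff[OF finite_positive_words, of "\<lambda>n. num_relators k n d" "\<lambda>n. n" "\<lambda>_. k"]
    eventually_num_relators_le[OF assms]
  by (simp add: card_positive_words positive_gonal_model_def[abs_def])

text \<open>The ratio at \<open>n\<close> is bounded by the hypothesis's null sequence taken at n^j,
  which tends to infinity with \<open>n\<close>. \<open>failure_ratio_mono\<close> discards the
  surplus relators before the blocks are read off.\<close>

lemma overwhelming_T_positive_blocks:
  assumes d: "0 < d" "d < 1" and j: "j \<ge> 1"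
    and T: "overwhelming_T (positive_gonal_model k d)"
  shows "overwhelming_T (positive_gonal_model (j * k) d)"
proof -
  let ?F = "\<lambda>n. failure_ratio n (positive_words n k) (num_relators k n d)"
  have lim: "filterlim (\<lambda>n :: nat. n ^ j) at_top sequentially"
  proof (rule filterlim_at_top_mono[OF filterlim_ident])
    show "\<forall>\<^sub>F n :: nat in sequentially. n \<le> n ^ j"
      using eventually_ge_at_top[of 1] by eventually_elim (use j in \<open>auto intro: self_le_power\<close>)
  qed
  have "?F \<longlonglongrightarrow> 0" using T overwhelming_T_positive_iff d by blast
  from filterlim_compose[OF this lim] have F: "(\<lambda>n. ?F (n ^ j)) \<longlonglongrightarrow> 0" .
  have "\<forall>\<^sub>F n in sequentially. num_relators k (n ^ j) d \<le> (n ^ j) ^ k"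
    using eventually_num_relators_le[OF d(2), of k] lim by (rule eventually_compose_filterlim)
  moreover have "\<forall>\<^sub>F n :: nat in sequentially. n \<ge> 1" by (rule eventually_ge_at_top)
  ultimately have "\<forall>\<^sub>F n in sequentially.
      failure_ratio n (positive_words n (j * k)) (num_relators (j * k) n d) \<le> ?F (n ^ j)"
  proof eventually_elim
    case (elim n)
    have "failure_ratio n (positive_words n (j * k)) (num_relators (j * k) n d)
        \<le> failure_ratio n (positive_words n (j * k)) (num_relators k (n ^ j) d)"
      using elim d by (intro failure_ratio_mono num_relators_blocks finite_positive_words
          positive_words_subset_words) (auto simp: card_positive_words power_mult)
    also have "\<dots> \<le> ?F (n ^ j)" using elim j by (intro failure_ratio_blocks) auto
    finally show ?case .
  qed
  then have "(\<lambda>n. failure_ratio n (positive_words n (j * k)) (num_relators (j * k) n d)) \<longlonglongrightarrow> 0"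
    using F by (intro tendsto_sandwich[OF _ _ tendsto_const F]) (auto simp: failure_ratio_nonneg)
  then show ?thesis using overwhelming_T_positive_iff d by blast
qed

text \<open>There are n^k positive words against at most (2n)^k cyclically reduced ones, so the mean
  number of positive relators is at least \<open>m n / 2 ^ k\<close>. It tends to infinity, which
  makes the Chebyshev term vanish, and it eventually exceeds twice the number of relators at the
  lower density \<open>d'\<close>.\<close>

lemma overwhelming_T_gonal_of_positive:
  assumes d: "0 < d'" "d' < d" "d < 1" and k: "k \<ge> 1"
    and T: "overwhelming_T (positive_gonal_model k d')"
  shows "overwhelming_T (gonal_model k d)"
proof -
  define C where "C n = cyc_reduced_words n k" for n
  define P where "P n = positive_words n k" for n
  define m where "m n = num_relators k n d" for n
  define a where "a n = num_relators k n d'" for n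
  have PC: "P n \<subseteq> C n" "finite (C n)" for n
    by (simp_all add: P_def C_def positive_words_cyc_reduced finite_cyc_reduced_words)
  have CW: "C n \<subseteq> words {..<n}" for n by (auto simp: C_def cyc_reduced_words_def)
  have cardP: "card (P n) = n ^ k" for n by (simp add: P_def card_positive_words)
  have cardPC: "card (P n) \<le> card (C n)" for n by (rule card_mono[OF PC(2,1)])
  have ratio: "card (C n) \<le> 2 ^ k * card (P n)" for n
    using card_cyc_reduced_words_le[of n k] by (simp add: C_def cardP power_mult_distrib)
  have m_le: "\<forall>\<^sub>F n in sequentially. m n \<le> n ^ k"
    unfolding m_def by (rule eventually_num_relators_le) (rule d)
  have a_le: "\<forall>\<^sub>F n in sequentially. a n \<le> n ^ k"
    unfolding a_def by (rule eventually_num_relators_le) (use d in linarith)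
  have kd: "0 < real k * d'" "real k * d' < real k * d" using d k by auto
  \<comment> \<open>Of the factor 2^(k+1), 2^k is the share of positive words and 2 comes from the
    requirement that \<open>a n\<close> be at most half the mean; the added 1 pays for rounding
    \<open>m n\<close> down.\<close>
  have compare: "\<forall>\<^sub>F n in sequentially.
      2 ^ (k + 1) * (2 * real n - 1) powr (real k * d') + 1 \<le> (2 * real n - 1) powr (real k * d)"
  proof -
    have "\<forall>\<^sub>F x :: real in at_top. 2 ^ (k + 1) * x powr (real k * d') + 1 \<le> x powr (real k * d)"
      using kd by real_asymp
    moreover have "filterlim (\<lambda>n :: nat. 2 * real n - 1) at_top sequentially" by real_asymp
    ultimately show ?thesis by (rule eventually_compose_filterlim)
  qed
  have am: "\<forall>\<^sub>F n in sequentially. 2 ^ (k + 1) * real (a n) \<le> real (m n)"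
    using compare
  proof eventually_elim
    case (elim n)
    let ?x = "(2 * real n - 1) powr (real k * d')" and ?y = "(2 * real n - 1) powr (real k * d)"
    have "real (a n) \<le> ?x" by (simp add: a_def num_relators_def)
    then have "2 ^ (k + 1) * real (a n) \<le> 2 ^ (k + 1) * ?x" by (intro mult_left_mono) auto
    moreover have "?y - 1 \<le> real (m n)" unfolding m_def num_relators_def by linarith
    ultimately show ?case using elim by linarith
  qed
  have m_lim: "filterlim (\<lambda>n. real (m n)) at_top sequentially"
  proof (rule filterlim_at_top_mono)
    show "filterlim (\<lambda>n. (2 * real n - 1) powr (real k * d) - 1) at_top sequentially"
      using kd by real_asymp
    show "\<forall>\<^sub>F n in sequentially. (2 * real n - 1) powr (real k * d) - 1 \<le> real (m n)"
      unfolding m_def num_relators_def by (intro always_eventually allI) linarith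
  qed
  have bound: "\<forall>\<^sub>F n in sequentially. failure_ratio n (C n) (m n) \<le>
      4 * 2 ^ k / real (m n) + failure_ratio n (P n) (a n)"
  proof -
    have "\<forall>\<^sub>F n in sequentially. 0 < real (m n)" using m_lim by (rule filterlim_at_top_dense[THEN iffD1, rule_format])
    moreover have "\<forall>\<^sub>F n :: nat in sequentially. n \<ge> 1" by (rule eventually_ge_at_top)
    ultimately show ?thesis using m_le a_le am
    proof eventually_elim
      case (elim n)
      define \<mu> where "\<mu> = real (card (P n)) * real (m n) / real (card (C n))"
      have P0: "card (P n) > 0" using elim by (simp add: cardP)
      then have C0: "card (C n) > 0" using cardPC[of n] by linarith
      have "real (card (C n)) \<le> 2 ^ k * real (card (P n))"
        using of_nat_mono[OF ratio[of n], where 'a = real] by simp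
      then have "real (m n) * real (card (C n)) \<le> real (m n) * (2 ^ k * real (card (P n)))"
        by (intro mult_left_mono) auto
      then have \<mu>: "real (m n) / 2 ^ k \<le> \<mu>"
        using C0 by (simp add: \<mu>_def field_simps)
      have "2 * real (a n) \<le> real (m n) / 2 ^ k" using elim by (simp add: field_simps)
      then have a\<mu>: "2 * real (a n) \<le> \<mu>" using \<mu> by linarith
      have "failure_ratio n (C n) (m n) \<le> 4 / \<mu> + failure_ratio n (P n) (a n)"
      proof (rule failure_ratio_trace[OF _ PC(2) CW PC(1) _ _ _ _ \<mu>_def a\<mu>])
        show "P n \<noteq> {}" using P0 by auto
        show "m n \<le> card (C n)" using elim cardPC[of n] by (simp add: cardP)
      qed (use elim in \<open>simp_all add: cardP\<close>)
      moreover have "4 / \<mu> \<le> 4 / (real (m n) / 2 ^ k)"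
        using \<mu> elim by (intro divide_left_mono mult_pos_pos less_le_trans[OF _ \<mu>]) auto
      ultimately show ?case by simp
    qed
  qed
  have "(\<lambda>n. failure_ratio n (P n) (a n)) \<longlonglongrightarrow> 0"
    using T overwhelming_T_positive_iff[of d' k] d by (simp add: P_def a_def)
  moreover have "(\<lambda>n. 4 * 2 ^ k / real (m n)) \<longlonglongrightarrow> 0"
    by (rule tendsto_divide_0[OF tendsto_const]) (rule filterlim_at_top_imp_at_infinity[OF m_lim])
  ultimately have upper: "(\<lambda>n. 4 * 2 ^ k / real (m n) + failure_ratio n (P n) (a n)) \<longlonglongrightarrow> 0"
    by (rule tendsto_add_zero[rotated])
  have "(\<lambda>n. failure_ratio n (C n) (m n)) \<longlonglongrightarrow> 0"
    using bound by (intro tendsto_sandwich[OF _ _ tendsto_const upper]) (auto simp: failure_ratio_nonneg)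
  moreover have "\<forall>\<^sub>F n in sequentially. m n \<le> card (C n)"
    using m_le by eventually_elim (use cardPC cardP in \<open>metis le_trans\<close>)
  ultimately have "overwhelming_T (\<lambda>n. pmf_of_set {R. R \<subseteq> C n \<and> card R = m n})"
    by (subst overwhelming_T_iff) (simp_all add: PC(2))
  then show ?thesis by (simp add: gonal_model_def[abs_def] C_def m_def)
qed

theorem theorem1p1:
  fixes d0 :: real and k :: nat
  assumes "0 < d0" and "d0 < 1" and "k \<ge> 1"
    and "\<And>d. d0 < d \<Longrightarrow> d < 1 \<Longrightarrow> overwhelming_T (positive_gonal_model k d)"
  shows "\<forall>d d' j. d0 < d \<and> d < 1 \<and> d0 < d' \<and> d' < d \<and> j \<ge> 1 \<longrightarrow>
           overwhelming_T (gonal_model (j * k) d') \<and>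
           overwhelming_T (positive_gonal_model (j * k) d')"
proof (intro allI impI)
  fix d d' :: real and j :: nat
  assume *: "d0 < d \<and> d < 1 \<and> d0 < d' \<and> d' < d \<and> j \<ge> 1"
  have positive: "overwhelming_T (positive_gonal_model (j * k) x)" if "d0 < x" "x < 1" for x
    using that assms * by (intro overwhelming_T_positive_blocks assms(4)) auto
  \<comment> \<open>The positive model is used at a density strictly below \<open>d'\<close>, so
    that the constant share of positive words is absorbed, and still above \<open>d0\<close>, where
    the hypothesis applies.\<close>
  obtain x where x: "d0 < x" "x < d'" using * dense by blast
  have "j * k \<ge> 1" using * assms(3) by (cases j; cases k) auto
  then have "overwhelming_T (gonal_model (j * k) d')"
    using positive[of x] x * assms(1)
    by (intro overwhelming_T_gonal_of_positive[of x d']) auto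
  then show "overwhelming_T (gonal_model (j * k) d') \<and> overwhelming_T (positive_gonal_model (j * k) d')"
    using positive[of d'] * by auto
qed

end
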